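(* Let $p$ be an odd prime, $\omega=e^{2\pi i/p}$, $K=\mathbb{Q}(\omega)$, and for a positive integer $N$ let $$B(p,N)=\Big\{a_1\omega+\cdots+a_{p-1}\omega^{p-1}: a_1,\dots,a_{p-1}\in[-N,N]\cap\mathbb{Z}\Big\}.$$ For any $\varepsilon>0$ there exists an absolute and effectively computable constant $A(\varepsilon)$ such that if $N>A(\varepsilon)$ and $p>A(\varepsilon)$, then $$\frac{1}{\#B(p,N)^{2}}\#\left\{(\alpha,\beta)\in B(p,N)\times B(p,N):\left|\mathfrak{d}_{p,N}(\alpha,\beta)-\frac{1}{\sqrt{6}}\right|>\varepsilon\right\}<\varepsilon.$$
   Context: $\operatorname{Tr}_{K/\mathbb{Q}}(\alpha)=\sum_{\sigma\in\operatorname{Gal}(K/\mathbb{Q})}\sigma(\alpha)$. For $\alpha\in K$, $\|\alpha\|=\sqrt{\sum_{j=1}^{p-1}\operatorname{Tr}_{K/\mathbb{Q}}(\alpha\omega^j)^2}$, and $d(\alpha,\beta)=\|\alpha-\beta\|$. The normalized distance is $\mathfrak{d}_{p,N}(\alpha,\beta)=\dfrac{d(\alpha,\beta)}{2Np\sqrt{p-1}}$. *)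

theory Defs
  imports
    "HOL-Algebra.Algebraic_Closure_Type"
    "HOL-Algebra.Generated_Fields"
    "HOL-Analysis.Analysis"
begin

definition root_of_unity :: "nat \<Rightarrow> complex" where
  "root_of_unity p = exp (2 * of_real pi * \<i> / of_nat p)"

text \<open>
  \<open>\<rat>(\<omega>)\<close>, as a subfield of the complex numbers. Every subfield of \<open>\<complex>\<close> contains \<open>\<rat>\<close>,
  so the subfield generated by \<open>\<omega>\<close> alone is the extension of \<open>\<rat>\<close> generated by \<open>\<omega>\<close>.
\<close>

definition cyclotomic_field :: "nat \<Rightarrow> complex ring" where
  "cyclotomic_field p =
     ring_of_type_algebra\<lparr>carrier := generate_field ring_of_type_algebra {root_of_unity p}\<rparr>"

text \<open>
  HOL functions are total on \<open>\<complex>\<close>; the restriction to \<open>extensional\<close> functions makes each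
  automorphism of the field correspond to exactly one element of the set below.
\<close>

definition galois_group_over_rats :: "complex ring \<Rightarrow> (complex \<Rightarrow> complex) set" where
  "galois_group_over_rats K =
     {\<sigma> \<in> ring_iso K K \<inter> extensional (carrier K). \<forall>x\<in>\<rat>. \<sigma> x = x}"

definition field_trace :: "complex ring \<Rightarrow> complex \<Rightarrow> complex" where
  "field_trace K \<alpha> = (\<Sum>\<sigma>\<in>galois_group_over_rats K. \<sigma> \<alpha>)"

text \<open>
  For \<open>\<alpha>\<close> in the field, the traces are rational; \<open>Re\<close> serves only to convert them from type
  \<open>complex\<close> to type \<open>real\<close>.
\<close>

definition trace_norm :: "nat \<Rightarrow> complex \<Rightarrow> real" where
  "trace_norm p \<alpha> =
     sqrt (\<Sum>j=1..p-1. (Re (field_trace (cyclotomic_field p) (\<alpha> * root_of_unity p ^ j)))\<^sup>2)"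

definition trace_dist :: "nat \<Rightarrow> complex \<Rightarrow> complex \<Rightarrow> real" where
  "trace_dist p \<alpha> \<beta> = trace_norm p (\<alpha> - \<beta>)"

definition normalized_dist :: "nat \<Rightarrow> nat \<Rightarrow> complex \<Rightarrow> complex \<Rightarrow> real" where
  "normalized_dist p N \<alpha> \<beta> = trace_dist p \<alpha> \<beta> / (2 * real N * real p * sqrt (real p - 1))"

definition coeff_box :: "nat \<Rightarrow> nat \<Rightarrow> complex set" where
  "coeff_box p N = {(\<Sum>j=1..p-1. of_int (a j) * root_of_unity p ^ j) | a :: nat \<Rightarrow> int.
                \<forall>j\<in>{1..p-1}. a j \<in> {- int N..int N}}"

text \<open>
  \<open>total_recursive n f\<close>: on lists of length \<open>n\<close>, \<open>f\<close> is a total recursive function of \<open>n\<close>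
  arguments. Its values on lists of any other length carry no meaning. Minimisation is allowed
  only where a zero always exists, which suffices to obtain all total recursive functions
  (Kleene normal form).
\<close>

inductive total_recursive :: "nat \<Rightarrow> (nat list \<Rightarrow> nat) \<Rightarrow> bool" where
  zero: "total_recursive n (\<lambda>xs. 0)"
| succ: "total_recursive 1 (\<lambda>xs. Suc (xs ! 0))"
| proj: "i < n \<Longrightarrow> total_recursive n (\<lambda>xs. xs ! i)"
| comp: "\<lbrakk>total_recursive (length gs) f; \<forall>g\<in>set gs. total_recursive n g\<rbrakk>
    \<Longrightarrow> total_recursive n (\<lambda>xs. f (map (\<lambda>g. g xs) gs))"
| prec: "\<lbrakk>total_recursive n f; total_recursive (Suc (Suc n)) g\<rbrakk>
    \<Longrightarrow> total_recursive (Suc n)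
          (\<lambda>xs. rec_nat (f (tl xs)) (\<lambda>k r. g (k # r # tl xs)) (hd xs))"
| minim: "\<lbrakk>total_recursive (Suc n) f; \<forall>xs. length xs = n \<longrightarrow> (\<exists>k. f (k # xs) = 0)\<rbrakk>
    \<Longrightarrow> total_recursive n (\<lambda>xs. LEAST k. f (k # xs) = 0)"

text \<open>
  A bound depending on a real parameter \<open>\<epsilon> > 0\<close> is effectively computable if some algorithm
  outputs it from numerator and denominator of any rational \<open>\<epsilon>\<close>. (Real arguments are not
  finite data; for a property that becomes weaker as \<open>\<epsilon>\<close> grows, a bound for an irrational
  \<open>\<epsilon>\<close> is computed at a smaller positive rational.)
\<close>

definition effectively_computable :: "(real \<Rightarrow> nat) \<Rightarrow> bool" where
  "effectively_computable A \<longleftrightarrow>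
     (\<exists>F. total_recursive 2 F \<and> (\<forall>m>0. \<forall>n>0. A (real m / real n) = F [m, n]))"

end

theory Submission
  imports Defs
begin

text \<open>
  The Galois group of \<open>K\<close> sends \<open>\<omega>\<close> to each \<open>\<omega>\<^sup>k\<close> with \<open>0 < k < p\<close> exactly once (Eisenstein), so
  \<open>Tr (\<omega>\<^sup>m)\<close> is \<open>p - 1\<close> or \<open>-1\<close> according to whether \<open>p\<close> divides \<open>m\<close>. Hence an element with coefficients
  \<open>c\<^sub>j\<close> has squared norm \<open>p\<^sup>2 U - (p + 1) S\<^sup>2\<close>, where \<open>U\<close> is the sum of the \<open>c\<^sub>j\<^sup>2\<close> and \<open>S\<close> the sum of
  the \<open>c\<^sub>j\<close>. If \<open>\<alpha>\<close> and \<open>\<beta>\<close> are drawn uniformly from the box, the coefficients of \<open>\<alpha> - \<beta>\<close> are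
  independent and centred with variance \<open>2 N (N + 1) / 3\<close>. After normalisation \<open>U\<close> concentrates
  around \<open>1/6\<close> by Chebyshev's inequality, while \<open>S\<^sup>2\<close> contributes \<open>O(1/p)\<close> by Markov's inequality. This gives
  the explicit bound \<open>A(\<epsilon>) = 100 \<lceil>1/\<epsilon>\<rceil>\<^sup>3\<close>.
\<close>

subsection \<open>Irreducibility of the cyclotomic polynomial\<close>

text \<open>If \<open>g\<close> had positive degree, \<open>h\<close> would have degree below that
  of \<open>g * h\<close>. As \<open>p\<close> does not divide the constant term of
  \<open>g\<close>, comparing the coefficients of \<open>g * h\<close> one after another would make
  \<open>p\<close> divide every coefficient of \<open>h\<close>, the leading one included.\<close>

lemma eisenstein_aux:
  fixes g h :: "'a :: idom poly"
  assumes p: "prime_elem p" and coeffs: "\<And>i. i < Polynomial.degree (g * h) \<Longrightarrow> p dvd poly.coeff (g * h) i"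
    and lead: "\<not> p dvd Polynomial.lead_coeff (g * h)" and g0: "\<not> p dvd poly.coeff g 0"
  shows "Polynomial.degree g = 0"
proof (rule ccontr)
  assume pos: "Polynomial.degree g \<noteq> 0"
  have "g \<noteq> 0" "h \<noteq> 0"
    using lead by auto
  then have deg: "Polynomial.degree (g * h) = Polynomial.degree g + Polynomial.degree h"
    by (rule degree_mult_eq)
  have "p dvd poly.coeff h i" if "i < Polynomial.degree (g * h)" for i
    using that
  proof (induction i rule: less_induct)
    case (less i)
    have "poly.coeff (g * h) i = (\<Sum>j\<le>i. poly.coeff g j * poly.coeff h (i - j))"
      by (rule coeff_mult)
    also have "\<dots> = poly.coeff g 0 * poly.coeff h i + (\<Sum>j\<in>{..i} - {0}. poly.coeff g j * poly.coeff h (i - j))"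
      by (subst sum.remove[of _ 0]) auto
    finally have eq: "poly.coeff g 0 * poly.coeff h i =
        poly.coeff (g * h) i - (\<Sum>j\<in>{..i} - {0}. poly.coeff g j * poly.coeff h (i - j))"
      by simp
    have "p dvd (\<Sum>j\<in>{..i} - {0}. poly.coeff g j * poly.coeff h (i - j))"
      using less by (intro dvd_sum dvd_mult) auto
    with eq less coeffs have "p dvd poly.coeff g 0 * poly.coeff h i"
      by simp
    with p g0 show ?case
      by (simp add: prime_elem_dvd_mult_iff)
  qed
  then have "p dvd Polynomial.lead_coeff h"
    using pos deg by simp
  with lead show False
    by (simp add: lead_coeff_mult)
qed

text \<open>By \<open>const\<close>, the prime \<open>p\<close> divides at most one of the two
  constant terms; the auxiliary lemma applies to a factor whose constant term it does not
  divide.\<close>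

lemma eisenstein:
  fixes g h :: "'a :: idom poly"
  assumes p: "prime_elem p" and coeffs: "\<And>i. i < Polynomial.degree (g * h) \<Longrightarrow> p dvd poly.coeff (g * h) i"
    and lead: "\<not> p dvd Polynomial.lead_coeff (g * h)" and const: "\<not> p\<^sup>2 dvd poly.coeff (g * h) 0"
  shows "Polynomial.degree g = 0 \<or> Polynomial.degree h = 0"
proof (cases "p dvd poly.coeff g 0")
  case True
  then have "\<not> p dvd poly.coeff h 0"
    using const mult_dvd_mono[of p "poly.coeff g 0" p "poly.coeff h 0"]
    by (auto simp: coeff_mult power2_eq_square)
  then show ?thesis
    using eisenstein_aux[of p h g] p coeffs lead by (auto simp: mult.commute)
next
  case False
  then show ?thesis
    using eisenstein_aux[of p g h] p coeffs lead by auto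
qed

text \<open>For prime \<open>p\<close> this is the \<open>p\<close>-th cyclotomic
  polynomial.\<close>

definition prime_cyclotomic :: "nat \<Rightarrow> int poly" where
  "prime_cyclotomic p = (\<Sum>i<p. Polynomial.monom 1 i)"

lemma coeff_prime_cyclotomic: "poly.coeff (prime_cyclotomic p) i = (if i < p then 1 else 0)"
  by (simp add: prime_cyclotomic_def coeff_sum)

lemma degree_prime_cyclotomic: "Polynomial.degree (prime_cyclotomic p) = p - 1"
proof (cases "p = 0")
  case False
  show ?thesis
  proof (rule antisym)
    show "Polynomial.degree (prime_cyclotomic p) \<le> p - 1"
      by (intro degree_le) (auto simp: coeff_prime_cyclotomic)
    show "p - 1 \<le> Polynomial.degree (prime_cyclotomic p)"
      using False by (intro le_degree) (auto simp: coeff_prime_cyclotomic)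
  qed
qed (simp add: prime_cyclotomic_def)

lemma prime_cyclotomic_nonzero: "p > 0 \<Longrightarrow> prime_cyclotomic p \<noteq> 0"
  using coeff_prime_cyclotomic[of p 0] by auto

text \<open>Putting X + 1 for X in (X - 1) \<Phi>(X) = X^p - 1 gives X \<Phi>(X + 1) = (X + 1)^p -
  1, and the binomial theorem yields the coefficients.\<close>

lemma coeff_shifted_prime_cyclotomic:
  assumes "p > 0"
  shows "poly.coeff (prime_cyclotomic p \<circ>\<^sub>p [:1, 1:]) i = int (p choose Suc i)"
proof -
  have "Polynomial.monom 1 i \<circ>\<^sub>p q = q ^ i" for i and q :: "int poly"
    by (induction i) (simp_all add: monom_0 monom_Suc pcompose_pCons pcompose_1 flip: one_pCons)
  then have "prime_cyclotomic p \<circ>\<^sub>p [:1, 1:] = (\<Sum>i<p. [:1, 1:] ^ i)"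
    by (simp add: prime_cyclotomic_def pcompose_sum)
  then have "[:0, 1:] * (prime_cyclotomic p \<circ>\<^sub>p [:1, 1:]) = [:1, 1:] ^ p - 1"
    using power_diff_1_eq[of "[:1, 1:] :: int poly" p] by (simp add: one_pCons)
  then have "poly.coeff ([:0, 1:] * (prime_cyclotomic p \<circ>\<^sub>p [:1, 1:])) (Suc i) =
      poly.coeff ([:1, 1:] ^ p) (Suc i)"
    by (simp add: coeff_1)
  also have "\<dots> = int (p choose Suc i)"
    by (cases "Suc i \<le> p") (simp_all add: coeff_linear_poly_power coeff_eq_0 degree_linear_power binomial_eq_0)
  finally show ?thesis
    by (simp add: coeff_pCons)
qed

text \<open>The shift X -> X + 1 preserves products and degrees and produces an Eisenstein
  polynomial at \<open>p\<close>: the leading coefficient is 1, the constant term is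
  \<open>p\<close>, and \<open>p\<close> divides the binomial coefficients in between.\<close>

lemma irreducible_prime_cyclotomic:
  assumes p: "Factorial_Ring.prime p" and gh: "prime_cyclotomic p = g * h"
  shows "Polynomial.degree g = 0 \<or> Polynomial.degree h = 0"
proof -
  have p0: "p > 0"
    using p prime_gt_0_nat by blast
  let ?s = "\<lambda>f. f \<circ>\<^sub>p [:1, 1 :: int:]"
  have deg: "Polynomial.degree (?s f) = Polynomial.degree f" for f
    by (simp add: degree_pcompose)
  have eq: "?s g * ?s h = ?s (prime_cyclotomic p)"
    by (simp add: gh pcompose_mult)
  have "Polynomial.degree (?s g) = 0 \<or> Polynomial.degree (?s h) = 0"
  proof (rule eisenstein[of "int p"])
    show "prime_elem (int p)"
      using p by (simp add: prime_int_nat_transfer)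
    show "int p dvd poly.coeff (?s g * ?s h) i" if "i < Polynomial.degree (?s g * ?s h)" for i
    proof -
      have "p dvd p choose Suc i"
        using that p by (intro dvd_choose_prime) (auto simp: eq deg degree_prime_cyclotomic)
      then show ?thesis
        by (simp add: eq coeff_shifted_prime_cyclotomic[OF p0])
    qed
    show "\<not> int p dvd Polynomial.lead_coeff (?s g * ?s h)"
      using prime_gt_1_nat[OF p]
      by (simp add: eq coeff_shifted_prime_cyclotomic[OF p0] deg degree_prime_cyclotomic)
    show "\<not> (int p)\<^sup>2 dvd poly.coeff (?s g * ?s h) 0"
      using prime_gt_1_nat[OF p]
      by (auto simp add: eq coeff_shifted_prime_cyclotomic[OF p0] power2_eq_square simp del: coeff_pcompose_0 dest: zdvd_imp_le)
  qed
  then show ?thesis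
    by (simp add: deg)
qed

lemma poly_map_poly_hom:
  fixes h :: "'a :: comm_ring_1 \<Rightarrow> 'b :: comm_ring_1"
  assumes zero: "h 0 = 0" and add: "\<And>x y. h (x + y) = h x + h y" and mult: "\<And>x y. h (x * y) = h x * h y"
  shows "poly (map_poly h (f + g)) z = poly (map_poly h f) z + poly (map_poly h g) z"
    and "poly (map_poly h (f * g)) z = poly (map_poly h f) z * poly (map_poly h g) z"
proof -
  show add': "poly (map_poly h (f + g)) z = poly (map_poly h f) z + poly (map_poly h g) z" for f g
    by (induction f g rule: poly_induct2) (simp_all add: map_poly_pCons zero add algebra_simps)
  have smult: "poly (map_poly h (smult c g)) z = h c * poly (map_poly h g) z" for c
    by (induction g) (simp_all add: map_poly_pCons zero mult algebra_simps)
  show "poly (map_poly h (f * g)) z = poly (map_poly h f) z * poly (map_poly h g) z"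
    by (induction f) (simp_all add: map_poly_pCons zero add' smult algebra_simps)
qed

lemmas poly_of_int_poly_add =
  poly_map_poly_hom(1)[of of_int, OF of_int_0 of_int_add of_int_mult]
lemmas poly_of_int_poly_mult =
  poly_map_poly_hom(2)[of of_int, OF of_int_0 of_int_add of_int_mult]
lemmas poly_of_rat_poly_add =
  poly_map_poly_hom(1)[of of_rat, OF of_rat_0 of_rat_add of_rat_mult]
lemmas poly_of_rat_poly_mult =
  poly_map_poly_hom(2)[of of_rat, OF of_rat_0 of_rat_add of_rat_mult]

lemma poly_prime_cyclotomic:
  fixes z :: complex
  shows "poly (map_poly of_int (prime_cyclotomic p)) z = (\<Sum>i<p. z ^ i)"
proof -
  have "map_poly of_int (prime_cyclotomic p) = (\<Sum>i<p. Polynomial.monom (1::complex) i)"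
    by (intro poly_eqI) (simp add: coeff_map_poly coeff_prime_cyclotomic coeff_sum)
  then show ?thesis
    by (simp add: poly_sum poly_monom)
qed

text \<open>A nonzero integer polynomial of least degree vanishing at \<open>z\<close>, made
  primitive, divides the cyclotomic polynomial; irreducibility forces its degree to be
  \<open>p - 1\<close>.\<close>

lemma degree_ge_if_int_poly_root:
  fixes z :: complex and q :: "int poly"
  assumes p: "Factorial_Ring.prime p" and z: "(\<Sum>i<p. z ^ i) = 0"
    and q: "q \<noteq> 0" "poly (map_poly of_int q) z = 0"
  shows "p - 1 \<le> Polynomial.degree q"
proof -
  let ?root = "\<lambda>q :: int poly. q \<noteq> 0 \<and> poly (map_poly of_int q) z = 0"
  obtain m where m: "?root m" and min: "\<And>f. ?root f \<Longrightarrow> Polynomial.degree m \<le> Polynomial.degree f"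
    using ex_has_least_nat[of ?root q Polynomial.degree] q by blast
  define g where "g = primitive_part m"
  have m_eq: "m = [:Polynomial.content m:] * g"
    by (simp add: g_def)
  have deg_g: "Polynomial.degree g = Polynomial.degree m"
    by (simp add: g_def)
  have content_g: "Polynomial.content g = 1"
    using m by (simp add: g_def)
  have "poly (map_poly of_int ([:Polynomial.content m:] * g)) z = 0"
    using m m_eq by metis
  then have g_root: "poly (map_poly of_int g) z = 0"
    using m by (simp add: poly_of_int_poly_mult map_poly_pCons del: mult_pCons_left)
  have g: "?root g"
    using g_root m by (auto simp: g_def)
  \<comment> \<open>Pseudo-division stays within integer polynomials at the cost of a factor
    \<open>a\<close>. The remainder vanishes at \<open>z\<close>, so minimality makes it
    zero.\<close>
  define r where "r = pseudo_mod (prime_cyclotomic p) g"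
  obtain a s where a: "a \<noteq> 0" and div: "smult a (prime_cyclotomic p) = g * s + r"
    using pseudo_mod(1)[of g "prime_cyclotomic p"] g by (auto simp: r_def)
  have "poly (map_poly of_int ([:a:] * prime_cyclotomic p)) z = poly (map_poly of_int (g * s + r)) z"
    using div by simp
  then have "poly (map_poly of_int r) z = 0"
    by (simp add: poly_of_int_poly_mult poly_of_int_poly_add g_root poly_prime_cyclotomic z del: mult_pCons_left)
  moreover have "r = 0 \<or> Polynomial.degree r < Polynomial.degree g"
    using pseudo_mod(2)[of g "prime_cyclotomic p"] g by (simp add: r_def)
  ultimately have "r = 0"
    using min[of r] deg_g leD by metis
  then have "fract_poly g * fract_poly s = smult (to_fract a) (fract_poly (prime_cyclotomic p))"
    using arg_cong[OF div, of fract_poly] by simp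
  then have "fract_poly g dvd fract_poly (prime_cyclotomic p)"
    using a by (metis dvd_smult_cancel dvd_triv_left to_fract_eq_0_iff)
  \<comment> \<open>Gauss's lemma: divisibility over the fraction field descends to the integers
    because \<open>g\<close> is primitive.\<close>
  then have "g dvd prime_cyclotomic p"
    using content_g by (rule fract_poly_dvdD)
  then obtain h where gh: "prime_cyclotomic p = g * h"
    by (elim dvdE)
  have "Polynomial.degree g \<noteq> 0"
  proof
    assume "Polynomial.degree g = 0"
    then obtain c where c: "g = [:c:]"
      by (rule degree_eq_zeroE)
    with g show False
      by (simp add: map_poly_pCons)
  qed
  then have "Polynomial.degree h = 0"
    using irreducible_prime_cyclotomic[OF p gh] by simp
  moreover have "h \<noteq> 0"
    using gh prime_cyclotomic_nonzero[of p] prime_gt_0_nat[OF p] by auto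
  ultimately have "Polynomial.degree g = p - 1"
    using g degree_mult_eq[of g h] degree_prime_cyclotomic[of p] unfolding gh by simp
  then show ?thesis
    using min[of q] q deg_g by simp
qed

section \<open>Rational polynomials evaluated at a root: the ring \<rat>[z]\<close>

definition rat_eval :: "complex \<Rightarrow> rat poly \<Rightarrow> complex" where
  "rat_eval z f = poly (map_poly of_rat f) z"

lemma rat_eval_add: "rat_eval z (f + g) = rat_eval z f + rat_eval z g"
  by (simp add: rat_eval_def poly_of_rat_poly_add)

lemma rat_eval_mult: "rat_eval z (f * g) = rat_eval z f * rat_eval z g"
  by (simp add: rat_eval_def poly_of_rat_poly_mult)

lemma rat_eval_const [simp]: "rat_eval z [:c:] = of_rat c"
  by (simp add: rat_eval_def map_poly_pCons)

lemma rat_eval_0 [simp]: "rat_eval z 0 = 0"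
  by (simp add: rat_eval_def)

lemma rat_eval_1 [simp]: "rat_eval z 1 = 1"
  by (simp add: rat_eval_def)

lemma rat_eval_X [simp]: "rat_eval z [:0, 1:] = z"
  by (simp add: rat_eval_def map_poly_pCons)

lemma rat_eval_minus: "rat_eval z (- f) = - rat_eval z f"
  using rat_eval_add[of z f "- f"] by (simp add: add_eq_0_iff)

lemma rat_eval_diff: "rat_eval z (f - g) = rat_eval z f - rat_eval z g"
  using rat_eval_add[of z f "- g"] by (simp add: rat_eval_minus)

lemma rat_poly_clear_denominators:
  fixes f :: "rat poly"
  obtains d :: int and g :: "int poly" where "d \<noteq> 0" "smult (of_int d) f = map_poly of_int g"
proof -
  have "\<exists>(d :: int) g. d \<noteq> 0 \<and> smult (of_int d) f = map_poly of_int g"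
  proof (induction f)
    case 0
    show ?case
      by (intro exI[of _ 1] exI[of _ 0]) simp
  next
    case (pCons a f)
    then obtain d g where dg: "d \<noteq> 0" "smult (of_int d) f = map_poly of_int g"
      by blast
    obtain n e where ne: "e > 0" "a = Rat.Fract n e"
      by (cases a) auto
    then have "of_int e * a = of_int n"
      by (simp add: Fract_of_int_quotient)
    then have "of_int (d * e) * a = of_int (d * n)"
      by simp
    moreover have "smult (of_int (d * e)) f = map_poly of_int (smult e g)"
    proof -
      have "smult (of_int (d * e)) f = smult (of_int e) (smult (of_int d) f)"
        by (simp add: mult.commute)
      then show ?thesis
        by (simp only: dg(2)) (simp add: map_poly_smult)
    qed
    ultimately have "smult (of_int (d * e)) (pCons a f) = map_poly of_int (pCons (d * n) (smult e g))"
      by (simp add: map_poly_pCons)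
    then show ?case
      using dg ne by (intro exI[of _ "d * e"] exI[of _ "pCons (d * n) (smult e g)"]) simp
  qed
  then show thesis
    using that by blast
qed

lemma degree_ge_if_rat_eval_eq_0:
  assumes p: "Factorial_Ring.prime p" and z: "(\<Sum>i<p. z ^ i) = 0"
    and f: "rat_eval z f = 0" "f \<noteq> 0"
  shows "p - 1 \<le> Polynomial.degree f"
proof -
  obtain d g where dg: "d \<noteq> 0" "smult (of_int d) f = map_poly of_int g"
    by (rule rat_poly_clear_denominators)
  have "rat_eval z ([:of_int d:] * f) = 0"
    by (simp only: rat_eval_mult f(1) mult_zero_right)
  then have "rat_eval z (map_poly of_int g) = 0"
    by (simp add: dg)
  then have root: "poly (map_poly of_int g) z = 0"
    by (simp add: rat_eval_def map_poly_map_poly o_def)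
  have deg: "Polynomial.degree g = Polynomial.degree f"
    using arg_cong[OF dg(2), of Polynomial.degree] dg(1) by (simp add: degree_map_poly)
  have "g \<noteq> 0"
    using dg f by auto
  then show ?thesis
    using degree_ge_if_int_poly_root[OF p z _ root] deg by simp
qed

abbreviation rat_cyclotomic :: "nat \<Rightarrow> rat poly" where
  "rat_cyclotomic p \<equiv> map_poly of_int (prime_cyclotomic p)"

lemma rat_eval_cyclotomic: "rat_eval z (rat_cyclotomic p) = (\<Sum>i<p. z ^ i)"
  by (simp add: rat_eval_def map_poly_map_poly o_def poly_prime_cyclotomic)

lemma degree_rat_cyclotomic: "Polynomial.degree (rat_cyclotomic p) = p - 1"
  by (simp add: degree_map_poly degree_prime_cyclotomic)

text \<open>Division by the cyclotomic polynomial leaves a remainder of degree below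
  \<open>p - 1\<close>, which can vanish at \<open>z\<close> only if it is zero. The criterion is
  the same for every root \<open>z\<close>; this is what makes the roots conjugate.\<close>

lemma rat_eval_eq_0_iff_dvd:
  assumes p: "Factorial_Ring.prime p" and z: "(\<Sum>i<p. z ^ i) = 0"
  shows "rat_eval z f = 0 \<longleftrightarrow> rat_cyclotomic p dvd f"
proof
  assume f: "rat_eval z f = 0"
  have p1: "p - 1 > 0"
    using prime_gt_1_nat[OF p] by simp
  have nz: "rat_cyclotomic p \<noteq> 0"
    using degree_rat_cyclotomic[of p] p1 by auto
  have "rat_eval z (rat_cyclotomic p * (f div rat_cyclotomic p) + f mod rat_cyclotomic p) = 0"
    using f by simp
  then have "rat_eval z (f mod rat_cyclotomic p) = 0"
    unfolding rat_eval_add rat_eval_mult by (simp add: rat_eval_cyclotomic z)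
  moreover have "f mod rat_cyclotomic p = 0 \<or> Polynomial.degree (f mod rat_cyclotomic p) < p - 1"
    using degree_mod_less[OF nz, of f] by (simp add: degree_rat_cyclotomic)
  ultimately have "f mod rat_cyclotomic p = 0"
    using degree_ge_if_rat_eval_eq_0[OF p z, of "f mod rat_cyclotomic p"] leD by blast
  then show "rat_cyclotomic p dvd f"
    by (simp add: dvd_eq_mod_eq_0)
qed (auto simp: rat_eval_mult rat_eval_cyclotomic z elim!: dvdE)

text \<open>The gcd of \<open>f\<close> and the cyclotomic polynomial does not vanish at
  \<open>z\<close>, so its cofactor does. The cofactor then has full degree \<open>p - 1\<close>,
  the gcd is constant, and Bezout's identity evaluated at \<open>z\<close> gives the
  inverse.\<close>

lemma rat_eval_inverse:
  assumes p: "Factorial_Ring.prime p" and z: "(\<Sum>i<p. z ^ i) = 0" and f: "rat_eval z f \<noteq> 0"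
  obtains g where "rat_eval z f * rat_eval z g = 1"
proof -
  let ?d = "gcd f (rat_cyclotomic p)"
  obtain e where e: "rat_cyclotomic p = ?d * e"
    using gcd_dvd2 by (rule dvdE)
  have nz: "rat_cyclotomic p \<noteq> 0"
    using degree_rat_cyclotomic[of p] prime_gt_1_nat[OF p] by auto
  then have e0: "e \<noteq> 0" "?d \<noteq> 0"
    using e by (metis mult_zero_right, metis mult_zero_left)
  have d_nz: "rat_eval z ?d \<noteq> 0"
  proof -
    obtain c where "f = ?d * c"
      using gcd_dvd1 by (rule dvdE)
    with f show ?thesis
      by (metis mult_zero_left rat_eval_mult)
  qed
  have "rat_eval z ?d * rat_eval z e = 0"
    using rat_eval_cyclotomic[of z p] z e by (metis rat_eval_mult)
  then have "rat_eval z e = 0"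
    using d_nz by simp
  then have "p - 1 \<le> Polynomial.degree e"
    using degree_ge_if_rat_eval_eq_0[OF p z] e0 by simp
  moreover have "Polynomial.degree ?d + Polynomial.degree e = p - 1"
    using degree_mult_eq[of ?d e] e0 e degree_rat_cyclotomic[of p] by simp
  ultimately have "Polynomial.degree ?d = 0"
    by simp
  then obtain c where c: "?d = [:c:]"
    by (rule degree_eq_zeroE)
  then have c0: "c \<noteq> 0"
    using e0 by auto
  obtain a b where "a * f + b * rat_cyclotomic p = ?d"
    using bezout_coefficients_fst_snd[of f "rat_cyclotomic p"] by blast
  then have "rat_eval z (a * f + b * rat_cyclotomic p) = of_rat c"
    using c by simp
  then have "rat_eval z a * rat_eval z f = of_rat c"
    by (simp add: rat_eval_add rat_eval_mult rat_eval_cyclotomic z)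
  then have "rat_eval z f * rat_eval z ([:inverse c:] * a) = 1"
    using c0 by (simp only: rat_eval_mult rat_eval_const of_rat_inverse) (simp add: field_simps)
  then show thesis
    by (rule that)
qed

subsection \<open>The Galois group and the trace\<close>

lemma ring_of_type_algebra_simps [simp]:
  "carrier ring_of_type_algebra = UNIV"
  "x \<otimes>\<^bsub>ring_of_type_algebra\<^esub> y = x * y"
  "x \<oplus>\<^bsub>ring_of_type_algebra\<^esub> y = x + y"
  "\<one>\<^bsub>ring_of_type_algebra\<^esub> = 1"
  "\<zero>\<^bsub>ring_of_type_algebra\<^esub> = 0"
  by (simp_all add: ring_of_type_algebra_def)

lemma ring_of_type_algebra_a_inv:
  fixes x :: "'a :: Fields.field"
  shows "\<ominus>\<^bsub>ring_of_type_algebra\<^esub> x = - x"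
proof -
  interpret field "ring_of_type_algebra :: 'a ring"
    by (rule field_from_type_algebra)
  show ?thesis
    by (rule minus_equality) simp_all
qed

lemma ring_of_type_algebra_m_inv:
  fixes x :: "'a :: Fields.field"
  assumes "x \<noteq> 0"
  shows "inv\<^bsub>ring_of_type_algebra\<^esub> x = inverse x"
proof -
  interpret field "ring_of_type_algebra :: 'a ring"
    by (rule field_from_type_algebra)
  show ?thesis
    using assms by (intro comm_inv_char) simp_all
qed

text \<open>For prime \<open>p\<close> these are the primitive \<open>p\<close>-th roots of unity.
  The vanishing sum is the form in which they are handled, being the value of the cyclotomic
  polynomial.\<close>

lemma sum_powers_eq_0_iff:
  fixes z :: "'a :: field_char_0"
  assumes "p > 0"
  shows "(\<Sum>i<p. z ^ i) = 0 \<longleftrightarrow> z ^ p = 1 \<and> z \<noteq> 1"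
proof (cases "z = 1")
  case False
  then show ?thesis
    by (simp add: geometric_sum)
qed (use assms in simp)

lemma root_of_unity_power_eq_1_iff:
  assumes "p > 0"
  shows "root_of_unity p ^ m = 1 \<longleftrightarrow> p dvd m"
proof -
  have "root_of_unity p ^ m = exp (2 * of_real pi * \<i> * of_nat m / of_nat p)"
    by (simp add: root_of_unity_def mult.commute mult.left_commute flip: exp_of_nat_mult)
  then show ?thesis
    using complex_root_unity_eq_1[of p m] assms by simp
qed

lemma power_p_eq_1_imp_power_of_root_of_unity:
  assumes "p > 0" "z ^ p = 1"
  obtains k where "k < p" "z = root_of_unity p ^ k"
proof -
  have "cis (2 * pi * real k / real p) = root_of_unity p ^ k" for k
    by (simp add: root_of_unity_def cis_conv_exp mult.commute mult.left_commute flip: exp_of_nat_mult)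
  then have "z \<in> (\<lambda>k. root_of_unity p ^ k) ` {..<p}"
    using Complex.bij_betw_roots_unity[OF assms(1)] assms(2) by (simp add: bij_betw_def)
  then show thesis
    using that by blast
qed

lemma rat_eval_pCons: "rat_eval z (pCons a f) = of_rat a + z * rat_eval z f"
  by (simp add: rat_eval_def map_poly_pCons)

lemma rat_eval_trans:
  assumes "w \<in> range (rat_eval z)"
  shows "rat_eval w f \<in> range (rat_eval z)"
proof -
  obtain g where g: "w = rat_eval z g"
    using assms by blast
  show ?thesis
  proof (induction f)
    case (pCons a f)
    then obtain h where "rat_eval w f = rat_eval z h"
      by blast
    then have "rat_eval w (pCons a f) = rat_eval z ([:a:] + g * h)"
      by (simp add: rat_eval_pCons rat_eval_add rat_eval_mult g)
    then show ?case
      by blast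
  qed (use rat_eval_0[of z] in \<open>metis rangeI rat_eval_0\<close>)
qed

text \<open>Used in both directions between \<omega> and a conjugate, each being a power of the
  other, so that both generate the same field.\<close>

lemma range_rat_eval_power:
  "rat_eval (z ^ k) f \<in> range (rat_eval z)"
proof (rule rat_eval_trans)
  show "z ^ k \<in> range (rat_eval z)"
  proof (induction k)
    case (Suc k)
    then obtain h where "z ^ k = rat_eval z h"
      by blast
    then have "z ^ Suc k = rat_eval z ([:0, 1:] * h)"
      by (simp only: rat_eval_mult rat_eval_X power_Suc)
    then show ?case
      by blast
  qed (use rat_eval_1[of z] in \<open>metis rangeI power_0\<close>)
qed

lemma of_rat_in_generate_field:
  "(of_rat r :: complex) \<in> generate_field ring_of_type_algebra H"
proof -
  let ?F = "generate_field ring_of_type_algebra H"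
  have add: "x + y \<in> ?F" if "x \<in> ?F" "y \<in> ?F" for x y
    using generate_field.eng_add[OF that] by simp
  have uminus: "- x \<in> ?F" if "x \<in> ?F" for x
    using generate_field.a_inv[OF that] by (simp add: ring_of_type_algebra_a_inv)
  have one: "1 \<in> ?F"
    using generate_field.one[of ring_of_type_algebra H] by simp
  have zero: "0 \<in> ?F"
    using add[OF one uminus[OF one]] by simp
  have nat: "of_nat n \<in> ?F" for n
    by (induction n) (simp_all add: zero add one)
  have int: "of_int n \<in> ?F" for n
    using nat uminus by (cases n rule: int_cases2) auto
  obtain a b where ab: "b > 0" "r = Rat.Fract a b"
    by (cases r) auto
  have "inverse (of_int b) \<in> ?F"
    using generate_field.m_inv[OF int[of b]] ab by (simp add: ring_of_type_algebra_m_inv)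
  then have "of_int a * inverse (of_int b) \<in> ?F"
    using generate_field.eng_mult[OF int[of a]] by simp
  then show ?thesis
    using ab by (simp add: Fract_of_int_quotient of_rat_divide divide_inverse of_rat_mult of_rat_inverse)
qed

lemma sum_powers_root_of_unity:
  assumes "Factorial_Ring.prime p"
  shows "(\<Sum>i<p. root_of_unity p ^ i) = 0"
proof -
  have p: "p > 1"
    using assms by (rule prime_gt_1_nat)
  then show ?thesis
    using root_of_unity_power_eq_1_iff[of p p] root_of_unity_power_eq_1_iff[of p 1]
    by (simp add: sum_powers_eq_0_iff)
qed

text \<open>The values of polynomials at \<omega> already form a field; closure under inverses, the
  one case that is not formal, is \<open>rat_eval_inverse\<close>.\<close>

lemma carrier_cyclotomic_field:
  assumes p: "Factorial_Ring.prime p"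
  shows "carrier (cyclotomic_field p) = range (rat_eval (root_of_unity p))"
proof -
  let ?w = "root_of_unity p"
  let ?F = "generate_field ring_of_type_algebra {?w}"
  have "x \<in> range (rat_eval ?w)" if "x \<in> ?F" for x
    using that
  proof (induction rule: generate_field.induct)
    case one
    then show ?case
      by (metis rangeI rat_eval_1 ring_of_type_algebra_simps(4))
  next
    case (incl h)
    then show ?case
      by (metis rangeI rat_eval_X singletonD)
  next
    case (a_inv h)
    then show ?case
      by (metis rangeE rangeI rat_eval_minus ring_of_type_algebra_a_inv)
  next
    case (m_inv h)
    then obtain f where f: "h = rat_eval ?w f" "h \<noteq> 0"
      by auto
    then obtain g where "h * rat_eval ?w g = 1"
      using rat_eval_inverse[OF p sum_powers_root_of_unity[OF p], of f] by auto
    then have "rat_eval ?w g = inv\<^bsub>ring_of_type_algebra\<^esub> h"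
      using f by (simp add: ring_of_type_algebra_m_inv inverse_unique)
    then show ?case
      by (metis rangeI)
  next
    case (eng_add h1 h2)
    then obtain f g where "h1 = rat_eval ?w f" "h2 = rat_eval ?w g"
      by auto
    then have "rat_eval ?w (f + g) = h1 \<oplus>\<^bsub>ring_of_type_algebra\<^esub> h2"
      by (simp add: rat_eval_add)
    then show ?case
      by (metis rangeI)
  next
    case (eng_mult h1 h2)
    then obtain f g where "h1 = rat_eval ?w f" "h2 = rat_eval ?w g"
      by auto
    then have "rat_eval ?w (f * g) = h1 \<otimes>\<^bsub>ring_of_type_algebra\<^esub> h2"
      by (simp add: rat_eval_mult)
    then show ?case
      by (metis rangeI)
  qed
  moreover have "rat_eval ?w f \<in> ?F" for f
  proof (induction f)
    case 0
    show ?case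
      using of_rat_in_generate_field[of 0] by simp
  next
    case (pCons a f)
    have "?w \<in> ?F"
      by (intro generate_field.incl) simp
    then have "?w * rat_eval ?w f \<in> ?F"
      using generate_field.eng_mult pCons.IH by fastforce
    then have "of_rat a + ?w * rat_eval ?w f \<in> ?F"
      using generate_field.eng_add[OF of_rat_in_generate_field[of a]] by fastforce
    then show ?case
      by (simp add: rat_eval_pCons)
  qed
  ultimately show ?thesis
    by (auto simp: cyclotomic_field_def)
qed

lemma cyclotomic_field_simps [simp]:
  "x \<otimes>\<^bsub>cyclotomic_field p\<^esub> y = x * y"
  "x \<oplus>\<^bsub>cyclotomic_field p\<^esub> y = x + y"
  "\<one>\<^bsub>cyclotomic_field p\<^esub> = 1"
  "\<zero>\<^bsub>cyclotomic_field p\<^esub> = 0"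
  by (simp_all add: cyclotomic_field_def ring_of_type_algebra_def)

text \<open>An automorphism preserves sums and products and fixes \<rat>, so it passes through
  polynomial expressions; hence its value at \<omega> determines it.\<close>

lemma galois_rat_eval:
  assumes p: "Factorial_Ring.prime p" and s: "s \<in> galois_group_over_rats (cyclotomic_field p)"
  shows "s (rat_eval (root_of_unity p) f) = rat_eval (s (root_of_unity p)) f"
proof -
  let ?w = "root_of_unity p" and ?K = "cyclotomic_field p"
  have iso: "s \<in> ring_iso ?K ?K" and rat: "\<And>x. x \<in> \<rat> \<Longrightarrow> s x = x"
    using s by (auto simp: galois_group_over_rats_def)
  have K: "rat_eval ?w f \<in> carrier ?K" for f
    by (simp add: carrier_cyclotomic_field[OF p])
  have add: "s (x + y) = s x + s y" and mult: "s (x * y) = s x * s y"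
    if "x \<in> carrier ?K" "y \<in> carrier ?K" for x y
    using ring_iso_memE(2,3)[OF iso that] by simp_all
  show ?thesis
  proof (induction f)
    case 0
    show ?case
      using rat[of 0] by simp
  next
    case (pCons a f)
    have "s (of_rat a + ?w * rat_eval ?w f) = s (of_rat a) + s (?w * rat_eval ?w f)"
      using K[of "[:a:]"] K[of "[:0, 1:] * f"] by (intro add) (simp_all only: rat_eval_const rat_eval_mult rat_eval_X)
    also have "s (?w * rat_eval ?w f) = s ?w * s (rat_eval ?w f)"
      using K[of "[:0, 1:]"] K[of f] by (intro mult) simp_all
    finally show ?case
      using pCons.IH rat[of "of_rat a"] by (simp add: rat_eval_pCons)
  qed
qed

text \<open>All roots share one minimal polynomial, so \<open>f - g\<close> vanishes at one exactly
  if it vanishes at another. This makes the substitution of a root for \<omega> well defined and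
  injective.\<close>

lemma rat_eval_eq_transfer:
  assumes p: "Factorial_Ring.prime p" and "(\<Sum>i<p. z ^ i) = 0" "(\<Sum>i<p. w ^ i) = 0"
    and eq: "rat_eval w f = rat_eval w g"
  shows "rat_eval z f = rat_eval z g"
  using rat_eval_eq_0_iff_dvd[OF p assms(2), of "f - g"] rat_eval_eq_0_iff_dvd[OF p assms(3), of "f - g"] eq
  by (simp add: rat_eval_diff)

lemma galois_exists:
  assumes p: "Factorial_Ring.prime p" and z: "(\<Sum>i<p. z ^ i) = 0"
  obtains s where "s \<in> galois_group_over_rats (cyclotomic_field p)" "s (root_of_unity p) = z"
proof -
  let ?w = "root_of_unity p" and ?K = "cyclotomic_field p"
  \<comment> \<open>The substitution f(\<omega>) -> f(z). The choice of \<open>f\<close> does not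
    affect the value, and \<open>restrict\<close> supplies the extensionality demanded by the
    definition of the group.\<close>
  define s where "s = restrict (\<lambda>x. rat_eval z (SOME f. rat_eval ?w f = x)) (carrier ?K)"
  have w: "(\<Sum>i<p. ?w ^ i) = 0"
    by (rule sum_powers_root_of_unity[OF p])
  have p0: "p > 0"
    using p by (rule prime_gt_0_nat)
  have s: "s (rat_eval ?w f) = rat_eval z f" for f
  proof -
    have "rat_eval ?w (SOME g. rat_eval ?w g = rat_eval ?w f) = rat_eval ?w f"
      by (rule someI[of _ f]) simp
    then have "rat_eval z (SOME g. rat_eval ?w g = rat_eval ?w f) = rat_eval z f"
      by (rule rat_eval_eq_transfer[OF p z w])
    then show ?thesis
      by (simp add: s_def carrier_cyclotomic_field[OF p])
  qed
  obtain k where k: "k < p" "z = ?w ^ k"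
    using power_p_eq_1_imp_power_of_root_of_unity[of p z] z p0 sum_powers_eq_0_iff[of p z] by blast
  have "k \<noteq> 0"
  proof
    assume "k = 0"
    with k z p0 show False
      by simp
  qed
  have "gcd k p = 1"
    using prime_imp_coprime[OF p, of k] nat_dvd_not_less[of k p] k \<open>k \<noteq> 0\<close>
    by (simp add: coprime_iff_gcd_eq_1 gcd.commute)
  then obtain x y where xy: "k * x = p * y + 1"
    using bezout_nat[OF \<open>k \<noteq> 0\<close>, of p] by auto
  \<comment> \<open>Here \<open>x\<close> inverts \<open>k\<close> modulo \<open>p\<close>, so
    \<omega> is in turn a power of \<open>z\<close>; this gives surjectivity.\<close>
  have "z ^ x = ?w ^ (p * y + 1)"
    unfolding k(2) xy[symmetric] by (rule power_mult[symmetric])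
  also have "\<dots> = ?w"
    using root_of_unity_power_eq_1_iff[OF p0, of "p * y"] by (simp add: power_add)
  finally have "z ^ x = ?w" .
  then have w_range: "rat_eval ?w f \<in> range (rat_eval z)" for f
    using range_rat_eval_power[of z x f] by simp
  have z_range: "rat_eval z f \<in> range (rat_eval ?w)" for f
    using range_rat_eval_power[of ?w k f] k by simp
  have "s \<in> ring_iso ?K ?K"
  proof (rule ring_iso_memI)
    show "bij_betw s (carrier ?K) (carrier ?K)"
    proof (rule bij_betw_imageI)
      show "inj_on s (carrier ?K)"
      proof (rule inj_onI)
        fix x y assume "x \<in> carrier ?K" "y \<in> carrier ?K" "s x = s y"
        moreover from this obtain f g where fg: "x = rat_eval ?w f" "y = rat_eval ?w g"
          by (auto simp: carrier_cyclotomic_field[OF p])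
        ultimately have "rat_eval z f = rat_eval z g"
          by (simp only: s)
        then show "x = y"
          unfolding fg by (rule rat_eval_eq_transfer[OF p w z])
      qed
      show "s ` carrier ?K = carrier ?K"
      proof
        show "s ` carrier ?K \<subseteq> carrier ?K"
          using z_range by (simp add: carrier_cyclotomic_field[OF p] s image_subset_iff)
        show "carrier ?K \<subseteq> s ` carrier ?K"
        proof
          fix x assume "x \<in> carrier ?K"
          then obtain g where "x = rat_eval ?w g"
            by (auto simp: carrier_cyclotomic_field[OF p])
          then obtain f where "x = rat_eval z f"
            using w_range[of g] by blast
          then have "x = s (rat_eval ?w f)"
            by (simp only: s)
          then show "x \<in> s ` carrier ?K"
            by (rule image_eqI) (simp add: carrier_cyclotomic_field[OF p])
        qed
      qed
    qed
  next
    fix x y assume "x \<in> carrier ?K" "y \<in> carrier ?K"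
    then obtain f g where fg: "x = rat_eval ?w f" "y = rat_eval ?w g"
      by (auto simp: carrier_cyclotomic_field[OF p])
    show "s (x \<otimes>\<^bsub>?K\<^esub> y) = s x \<otimes>\<^bsub>?K\<^esub> s y"
      using s[of "f * g"] by (simp add: fg s rat_eval_mult)
    show "s (x \<oplus>\<^bsub>?K\<^esub> y) = s x \<oplus>\<^bsub>?K\<^esub> s y"
      using s[of "f + g"] by (simp add: fg s rat_eval_add)
  next
    show "s \<one>\<^bsub>?K\<^esub> = \<one>\<^bsub>?K\<^esub>"
      using s[of 1] by simp
    show "s x \<in> carrier ?K" if "x \<in> carrier ?K" for x
    proof -
      obtain f where "x = rat_eval ?w f"
        using \<open>x \<in> carrier ?K\<close> by (auto simp: carrier_cyclotomic_field[OF p])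
      then show ?thesis
        using z_range[of f] by (simp only: s carrier_cyclotomic_field[OF p])
    qed
  qed
  moreover have "s x = x" if x: "x \<in> \<rat>" for x
  proof -
    obtain r where "x = of_rat r"
      using x by (rule Rats_cases)
    then show ?thesis
      using s[of "[:r:]"] by simp
  qed
  ultimately have "s \<in> galois_group_over_rats ?K"
    by (auto simp: galois_group_over_rats_def s_def)
  moreover have "s ?w = z"
    using s[of "[:0, 1:]"] by simp
  ultimately show thesis
    by (rule that)
qed

text \<open>An automorphism is determined by the image of \<omega>, which must again be a root of
  the cyclotomic polynomial, and \<open>galois_exists\<close> supplies every root.\<close>

lemma bij_betw_galois:
  assumes p: "Factorial_Ring.prime p"
  shows "bij_betw (\<lambda>s. s (root_of_unity p)) (galois_group_over_rats (cyclotomic_field p))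
    {z. (\<Sum>i<p. z ^ i) = 0}"
proof (rule bij_betw_imageI)
  let ?w = "root_of_unity p" and ?K = "cyclotomic_field p"
  let ?G = "galois_group_over_rats ?K"
  show "inj_on (\<lambda>s. s ?w) ?G"
  proof (rule inj_onI)
    fix s t assume st: "s \<in> ?G" "t \<in> ?G" "s ?w = t ?w"
    then have "s \<in> extensional (carrier ?K)" "t \<in> extensional (carrier ?K)"
      by (auto simp: galois_group_over_rats_def)
    moreover have "s x = t x" if x: "x \<in> carrier ?K" for x
    proof -
      obtain f where f: "x = rat_eval ?w f"
        using x by (auto simp: carrier_cyclotomic_field[OF p])
      show ?thesis
        unfolding f galois_rat_eval[OF p st(1)] galois_rat_eval[OF p st(2)] st(3) ..
    qed
    ultimately show "s = t"
      by (rule extensionalityI)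
  qed
  have "(\<Sum>i<p. s ?w ^ i) = 0" if "s \<in> ?G" for s
    using galois_rat_eval[OF p that, of "rat_cyclotomic p"] galois_rat_eval[OF p that, of 0]
    by (simp add: rat_eval_cyclotomic sum_powers_root_of_unity[OF p])
  moreover have "z \<in> (\<lambda>s. s ?w) ` ?G" if "(\<Sum>i<p. z ^ i) = 0" for z
    using galois_exists[OF p that] by (metis (no_types, lifting) image_eqI)
  ultimately show "(\<lambda>s. s ?w) ` ?G = {z. (\<Sum>i<p. z ^ i) = 0}"
    by blast
qed

section \<open>The trace and the norm in coordinates\<close>

lemma field_trace_rat_eval:
  assumes p: "Factorial_Ring.prime p"
  shows "field_trace (cyclotomic_field p) (rat_eval (root_of_unity p) f) =
    (\<Sum>z | (\<Sum>i<p. z ^ i) = 0. rat_eval z f)"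
proof -
  have "field_trace (cyclotomic_field p) (rat_eval (root_of_unity p) f) =
      (\<Sum>s\<in>galois_group_over_rats (cyclotomic_field p). rat_eval (s (root_of_unity p)) f)"
    unfolding field_trace_def using galois_rat_eval[OF p] by (intro sum.cong) auto
  also have "\<dots> = (\<Sum>z | (\<Sum>i<p. z ^ i) = 0. rat_eval z f)"
    by (rule sum.reindex_bij_betw[OF bij_betw_galois[OF p]])
  finally show ?thesis .
qed

text \<open>Including the root 1 completes the sum to all \<open>p\<close>-th roots of unity, the
  powers of \<omega>, and makes it a geometric sum of ratio \<omega>^m, which is \<open>p\<close> or
  0.\<close>

lemma sum_roots_power:
  assumes p: "p > 0"
  shows "(\<Sum>z | (\<Sum>i<p. z ^ i) = 0. z ^ m) = (if p dvd m then of_nat p - 1 else - 1 :: complex)"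
proof -
  let ?w = "root_of_unity p"
  have "cis (2 * pi * real k / real p) = ?w ^ k" for k
    by (simp add: root_of_unity_def cis_conv_exp mult.commute mult.left_commute flip: exp_of_nat_mult)
  then have bij: "bij_betw (\<lambda>k. ?w ^ k) {..<p} {z. z ^ p = 1}"
    using Complex.bij_betw_roots_unity[OF p] by simp
  have "{z :: complex. (\<Sum>i<p. z ^ i) = 0} = {z. z ^ p = 1} - {1}"
    using p by (auto simp: sum_powers_eq_0_iff)
  then have "(\<Sum>z | (\<Sum>i<p. z ^ i) = 0. z ^ m) = (\<Sum>z | z ^ p = 1. z ^ m) - (1 :: complex)"
    using p by (simp add: sum_diff1 finite_roots_unity)
  also have "(\<Sum>z | z ^ p = 1. z ^ m) = (\<Sum>k<p. (?w ^ m) ^ k)"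
    by (simp add: mult.commute flip: sum.reindex_bij_betw[OF bij] power_mult)
  also have "\<dots> = (if p dvd m then of_nat p else 0)"
  proof (cases "p dvd m")
    case True
    then show ?thesis
      using root_of_unity_power_eq_1_iff[OF p, of m] by simp
  next
    case False
    then have "?w ^ m \<noteq> 1" "(?w ^ m) ^ p = 1"
      using root_of_unity_power_eq_1_iff[OF p, of m] root_of_unity_power_eq_1_iff[OF p, of "m * p"]
      by (simp_all flip: power_mult)
    then show ?thesis
      using False p by (simp add: sum_powers_eq_0_iff)
  qed
  finally show ?thesis
    by simp
qed

text \<open>Among the exponents \<open>j + l\<close> only \<open>j = p - l\<close> gives a multiple
  of \<open>p\<close>, hence trace \<open>p - 1\<close>; every other power of \<omega> has trace
  -1.\<close>

lemma field_trace_lincomb: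
  assumes p: "Factorial_Ring.prime p" and l: "l \<in> {1..p-1}"
  shows "field_trace (cyclotomic_field p)
      ((\<Sum>j=1..p-1. of_int (c j) * root_of_unity p ^ j) * root_of_unity p ^ l) =
    of_int (int p * c (p - l) - (\<Sum>j=1..p-1. c j))"
proof -
  define f :: "rat poly" where "f = (\<Sum>j=1..p-1. Polynomial.monom (of_int (c j)) (j + l))"
  have "map_poly of_rat f = (\<Sum>j=1..p-1. Polynomial.monom (of_int (c j) :: complex) (j + l))"
    by (intro poly_eqI) (auto simp: f_def coeff_map_poly coeff_sum of_rat_sum intro!: sum.cong)
  then have f: "rat_eval z f = (\<Sum>j=1..p-1. of_int (c j) * z ^ (j + l))" for z
    by (simp add: rat_eval_def poly_sum poly_monom)
  have p0: "p > 0"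
    using p by (rule prime_gt_0_nat)
  have eq: "(\<Sum>j=1..p-1. of_int (c j) * root_of_unity p ^ j) * root_of_unity p ^ l =
      rat_eval (root_of_unity p) f"
    by (simp add: f sum_distrib_right power_add mult.assoc)
  have "field_trace (cyclotomic_field p)
      ((\<Sum>j=1..p-1. of_int (c j) * root_of_unity p ^ j) * root_of_unity p ^ l) =
    (\<Sum>z | (\<Sum>i<p. z ^ i) = 0. \<Sum>j=1..p-1. of_int (c j) * z ^ (j + l))"
    unfolding eq by (subst field_trace_rat_eval[OF p]) (simp only: f)
  also have "\<dots> = (\<Sum>j=1..p-1. of_int (c j) * (\<Sum>z | (\<Sum>i<p. z ^ i) = 0. z ^ (j + l)))"
    by (subst sum.swap) (simp add: sum_distrib_left)
  also have "\<dots> = (\<Sum>j=1..p-1. of_int (c j) * ((if j = p - l then of_nat p else 0) - 1))"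
  proof (intro sum.cong refl)
    fix j assume j: "j \<in> {1..p-1}"
    have "p dvd j + l \<longleftrightarrow> j = p - l"
    proof
      assume "p dvd j + l"
      then obtain q where q: "j + l = p * q"
        by (elim dvdE)
      \<comment> \<open>Only one multiple of \<open>p\<close> lies strictly between 0 and 2p, namely
        \<open>p\<close> itself.\<close>
      have "0 < j + l" "j + l < p * 2"
        using j l by auto
      then have "q = 1"
        unfolding q by simp
      with q show "j = p - l"
        by simp
    qed (use l in auto)
    then show "of_int (c j) * (\<Sum>z | (\<Sum>i<p. z ^ i) = 0. z ^ (j + l)) =
        (of_int (c j) :: complex) * ((if j = p - l then of_nat p else 0) - 1)"
      by (simp add: sum_roots_power[OF p0])
  qed
  also have "\<dots> = (\<Sum>j=1..p-1. (if j = p - l then of_int (c j) * of_nat p else 0) - of_int (c j))"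
    by (intro sum.cong) (auto simp: algebra_simps)
  also have "\<dots> = of_int (int p * c (p - l) - (\<Sum>j=1..p-1. c j))"
    using l by (auto simp: sum_subtractf sum.delta)
  finally show ?thesis .
qed

text \<open>The trace against \<omega>^l is p c(p - l) - S. Reflecting j -> p - j and expanding the
  squares leaves p^2 U - 2 p S^2 + (p - 1) S^2.\<close>

lemma trace_norm_lincomb:
  assumes p: "Factorial_Ring.prime p"
  shows "(trace_norm p (\<Sum>j=1..p-1. of_int (c j) * root_of_unity p ^ j))\<^sup>2 =
    (real p)\<^sup>2 * (\<Sum>j=1..p-1. (real_of_int (c j))\<^sup>2) - (real p + 1) * (\<Sum>j=1..p-1. real_of_int (c j))\<^sup>2"
proof -
  define S where "S = (\<Sum>j=1..p-1. real_of_int (c j))"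
  have p0: "p > 0"
    using p by (rule prime_gt_0_nat)
  have "(trace_norm p (\<Sum>j=1..p-1. of_int (c j) * root_of_unity p ^ j))\<^sup>2 =
      (\<Sum>l=1..p-1. (real p * real_of_int (c (p - l)) - S)\<^sup>2)"
    unfolding trace_norm_def
  proof (subst real_sqrt_pow2)
    show "(\<Sum>l=1..p-1. (Re (field_trace (cyclotomic_field p)
        ((\<Sum>j=1..p-1. of_int (c j) * root_of_unity p ^ j) * root_of_unity p ^ l)))\<^sup>2) =
      (\<Sum>l=1..p-1. (real p * real_of_int (c (p - l)) - S)\<^sup>2)"
    proof (intro sum.cong refl)
      fix l assume "l \<in> {1..p-1}"
      from field_trace_lincomb[OF p this, of c]
      show "(Re (field_trace (cyclotomic_field p)
          ((\<Sum>j=1..p-1. of_int (c j) * root_of_unity p ^ j) * root_of_unity p ^ l)))\<^sup>2 =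
        (real p * real_of_int (c (p - l)) - S)\<^sup>2"
        by (simp add: S_def)
    qed
  qed (auto intro: sum_nonneg)
  also have "\<dots> = (\<Sum>j=1..p-1. (real p * real_of_int (c j) - S)\<^sup>2)"
    by (rule sum.reindex_bij_witness[of _ "\<lambda>j. p - j" "\<lambda>j. p - j"]) auto
  also have "\<dots> = (\<Sum>j=1..p-1. (real p)\<^sup>2 * (real_of_int (c j))\<^sup>2 - 2 * real p * S * real_of_int (c j) + S\<^sup>2)"
    by (intro sum.cong) (auto simp: power2_eq_square algebra_simps)
  also have "\<dots> = (real p)\<^sup>2 * (\<Sum>j=1..p-1. (real_of_int (c j))\<^sup>2) - 2 * real p * S * S + real (p - 1) * S\<^sup>2"
    by (simp add: sum.distrib sum_subtractf S_def flip: sum_distrib_left)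
  also have "\<dots> = (real p)\<^sup>2 * (\<Sum>j=1..p-1. (real_of_int (c j))\<^sup>2) - (real p + 1) * S\<^sup>2"
    using p0 by (simp add: power2_eq_square algebra_simps of_nat_diff)
  finally show ?thesis
    by (simp add: S_def)
qed

subsection \<open>Computability of the bound\<close>

text \<open>
  The definition of total recursive functions prescribes values on argument lists of every length;
  only those on lists of length \<open>n\<close> matter here.
\<close>

definition computable :: "nat \<Rightarrow> (nat list \<Rightarrow> nat) \<Rightarrow> bool" where
  "computable n f \<longleftrightarrow> (\<exists>g. total_recursive n g \<and> (\<forall>xs. length xs = n \<longrightarrow> g xs = f xs))"

lemma computable_cong:
  assumes "computable n f" "\<And>xs. length xs = n \<Longrightarrow> f xs = g xs"
  shows "computable n g"
  using assms unfolding computable_def by metis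

lemma computable_proj: "i < n \<Longrightarrow> computable n (\<lambda>xs. xs ! i)"
  unfolding computable_def by (blast intro: total_recursive.proj)

lemma computable_comp1:
  assumes f: "computable 1 f" and g: "computable n g"
  shows "computable n (\<lambda>xs. f [g xs])"
proof -
  obtain f' g' where f': "total_recursive 1 f'" "\<And>xs. length xs = 1 \<Longrightarrow> f' xs = f xs"
    and g': "total_recursive n g'" "\<And>xs. length xs = n \<Longrightarrow> g' xs = g xs"
    using f g unfolding computable_def by blast
  then have "total_recursive n (\<lambda>xs. f' (map (\<lambda>g. g xs) [g']))"
    by (intro total_recursive.comp) auto
  then show ?thesis
    unfolding computable_def using f'(2) g'(2) by (auto intro!: exI)
qed

lemma computable_comp2:
  assumes f: "computable 2 f" and g: "computable n g" and h: "computable n h"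
  shows "computable n (\<lambda>xs. f [g xs, h xs])"
proof -
  obtain f' g' h' where f': "total_recursive 2 f'" "\<And>xs. length xs = 2 \<Longrightarrow> f' xs = f xs"
    and g': "total_recursive n g'" "\<And>xs. length xs = n \<Longrightarrow> g' xs = g xs"
    and h': "total_recursive n h'" "\<And>xs. length xs = n \<Longrightarrow> h' xs = h xs"
    using f g h unfolding computable_def by blast
  then have "total_recursive n (\<lambda>xs. f' (map (\<lambda>g. g xs) [g', h']))"
    by (intro total_recursive.comp) (auto simp: numeral_2_eq_2)
  then show ?thesis
    unfolding computable_def using f'(2) g'(2) h'(2) by (auto intro!: exI)
qed

lemma computable_prec:
  assumes f: "computable n f" and g: "computable (Suc (Suc n)) g"
  shows "computable (Suc n) (\<lambda>xs. rec_nat (f (tl xs)) (\<lambda>k r. g (k # r # tl xs)) (hd xs))"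
proof -
  obtain f' g' where f': "total_recursive n f'" "\<And>xs. length xs = n \<Longrightarrow> f' xs = f xs"
    and g': "total_recursive (Suc (Suc n)) g'" "\<And>xs. length xs = Suc (Suc n) \<Longrightarrow> g' xs = g xs"
    using f g unfolding computable_def by blast
  show ?thesis
    unfolding computable_def
  proof (intro exI conjI allI impI)
    show "total_recursive (Suc n) (\<lambda>xs. rec_nat (f' (tl xs)) (\<lambda>k r. g' (k # r # tl xs)) (hd xs))"
      by (rule total_recursive.prec) fact+
  qed (simp add: f' g')
qed

lemma computable_minim:
  assumes f: "computable (Suc n) f" and ex: "\<And>xs. length xs = n \<Longrightarrow> \<exists>k. f (k # xs) = 0"
  shows "computable n (\<lambda>xs. LEAST k. f (k # xs) = 0)"
proof -
  obtain f' where f': "total_recursive (Suc n) f'" "\<And>xs. length xs = Suc n \<Longrightarrow> f' xs = f xs"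
    using f unfolding computable_def by blast
  have "total_recursive n (\<lambda>xs. LEAST k. f' (k # xs) = 0)"
    by (rule total_recursive.minim) (use f' ex in auto)
  then show ?thesis
    unfolding computable_def using f' by (auto intro!: exI)
qed

lemma computable_Suc:
  assumes "computable n f"
  shows "computable n (\<lambda>xs. Suc (f xs))"
proof -
  have "computable 1 (\<lambda>xs. Suc (xs ! 0))"
    unfolding computable_def by (blast intro: total_recursive.succ)
  from computable_comp1[OF this assms] show ?thesis
    by simp
qed

lemma computable_const: "computable n (\<lambda>xs. c)"
proof (induction c)
  case 0
  show ?case
    unfolding computable_def by (blast intro: total_recursive.zero)
qed (rule computable_Suc)

lemma length_2_cases:
  assumes "length xs = 2"
  obtains x y where "xs = [x, y]"
  using assms by (auto simp: numeral_2_eq_2 length_Suc_conv)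

lemma computable_add:
  assumes "computable n f" "computable n g"
  shows "computable n (\<lambda>xs. f xs + g xs)"
proof -
  \<comment> \<open>Entry 0 of \<open>k # r # tl xs\<close> is the counter and entry 1 the previous
    value; the recursion runs over the first summand.\<close>
  have "computable (Suc 1) (\<lambda>xs. rec_nat (tl xs ! 0) (\<lambda>k r. Suc ((k # r # tl xs) ! 1)) (hd xs))"
    by (intro computable_prec[of 1 "\<lambda>xs. xs ! 0" "\<lambda>xs. Suc (xs ! 1)"])
      (auto intro!: computable_proj computable_Suc)
  then have "computable (Suc 1) (\<lambda>xs. xs ! 0 + xs ! 1)"
  proof (rule computable_cong)
    fix xs :: "nat list" assume "length xs = Suc 1"
    then obtain x y where "xs = [x, y]"
      by (auto simp: length_Suc_conv)
    then show "rec_nat (tl xs ! 0) (\<lambda>k r. Suc ((k # r # tl xs) ! 1)) (hd xs) = xs ! 0 + xs ! 1"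
      by (induction x arbitrary: xs) auto
  qed
  from computable_comp2[OF this[unfolded Suc_1] assms] show ?thesis
    by simp
qed

lemma computable_mult:
  assumes "computable n f" "computable n g"
  shows "computable n (\<lambda>xs. f xs * g xs)"
proof -
  have "computable (Suc 1) (\<lambda>xs. rec_nat 0 (\<lambda>k r. (k # r # tl xs) ! 1 + (k # r # tl xs) ! 2) (hd xs))"
    by (intro computable_prec[of 1 "\<lambda>xs. 0" "\<lambda>xs. xs ! 1 + xs ! 2"])
      (auto intro!: computable_proj computable_add computable_const)
  then have "computable (Suc 1) (\<lambda>xs. xs ! 0 * xs ! 1)"
  proof (rule computable_cong)
    fix xs :: "nat list" assume "length xs = Suc 1"
    then obtain x y where "xs = [x, y]"
      by (auto simp: length_Suc_conv)
    then show "rec_nat 0 (\<lambda>k r. (k # r # tl xs) ! 1 + (k # r # tl xs) ! 2) (hd xs) = xs ! 0 * xs ! 1"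
      by (induction x arbitrary: xs) auto
  qed
  from computable_comp2[OF this[unfolded Suc_1] assms] show ?thesis
    by simp
qed

lemma computable_diff:
  assumes "computable n f" "computable n g"
  shows "computable n (\<lambda>xs. f xs - g xs)"
proof -
  \<comment> \<open>Predecessor: the step function returns the counter, and 0 is sent to 0.\<close>
  have "computable (Suc 0) (\<lambda>xs. rec_nat 0 (\<lambda>k r. (k # r # tl xs) ! 0) (hd xs))"
    by (intro computable_prec[of 0 "\<lambda>xs. 0" "\<lambda>xs. xs ! 0"]) (auto intro!: computable_proj computable_const)
  then have "computable (Suc 0) (\<lambda>xs. xs ! 0 - 1)"
  proof (rule computable_cong)
    fix xs :: "nat list" assume "length xs = Suc 0"
    then obtain x where "xs = [x]"
      by (auto simp: length_Suc_conv)
    then show "rec_nat 0 (\<lambda>k r. (k # r # tl xs) ! 0) (hd xs) = xs ! 0 - 1"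
      by (cases x) auto
  qed
  from computable_comp1[OF this[folded One_nat_def] computable_proj[of 1 3]]
  have "computable 3 (\<lambda>xs. xs ! 1 - 1)"
    by simp
  \<comment> \<open>Subtraction iterates the predecessor. The recursion runs over the head of the
    list, so the subtrahend stands first and the closing composition swaps the arguments.\<close>
  then have "computable (Suc 1) (\<lambda>xs. rec_nat (tl xs ! 0) (\<lambda>k r. (k # r # tl xs) ! 1 - 1) (hd xs))"
    by (intro computable_prec[of 1 "\<lambda>xs. xs ! 0" "\<lambda>xs. xs ! 1 - 1"])
      (auto simp: numeral_3_eq_3 intro!: computable_proj)
  then have "computable (Suc 1) (\<lambda>xs. xs ! 1 - xs ! 0)"
  proof (rule computable_cong)
    fix xs :: "nat list" assume "length xs = Suc 1"
    then obtain x y where "xs = [x, y]"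
      by (auto simp: length_Suc_conv)
    then show "rec_nat (tl xs ! 0) (\<lambda>k r. (k # r # tl xs) ! 1 - 1) (hd xs) = xs ! 1 - xs ! 0"
      by (induction x arbitrary: xs) auto
  qed
  from computable_comp2[OF this[unfolded Suc_1] assms(2) assms(1)] show ?thesis
    by simp
qed

text \<open>The factor \<open>m\<close> makes the minimisation total also for the junk argument \<open>m = 0\<close>.\<close>

lemma nat_ceiling_eq_Least:
  assumes "m > 0"
  shows "(LEAST k. m * (n - k * m) = 0) = nat \<lceil>real n / real m\<rceil>"
proof (rule Least_equality)
  have le_iff: "m * (n - k * m) = 0 \<longleftrightarrow> real n / real m \<le> real k" for k
  proof -
    have "m * (n - k * m) = 0 \<longleftrightarrow> n \<le> k * m"
      using assms by auto
    also have "\<dots> \<longleftrightarrow> real n \<le> real k * real m"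
      by (simp flip: of_nat_mult)
    finally show ?thesis
      using assms by (simp add: field_simps)
  qed
  show "m * (n - nat \<lceil>real n / real m\<rceil> * m) = 0"
    unfolding le_iff by (rule real_nat_ceiling_ge)
  show "nat \<lceil>real n / real m\<rceil> \<le> k" if "m * (n - k * m) = 0" for k
    using that unfolding le_iff by (simp add: ceiling_le_iff nat_le_iff)
qed

lemma effectively_computable_ceiling_inverse_power:
  "effectively_computable (\<lambda>x. c * nat \<lceil>1 / x\<rceil> ^ 3)"
proof -
  \<comment> \<open>For \<open>xs = [m, n]\<close> the entries 0, 1, 2 of \<open>k # xs\<close> are
    \<open>k\<close>, \<open>m\<close>, \<open>n\<close>; when \<open>m > 0\<close> the search stops
    at the least \<open>k\<close> with \<open>n \<le> k * m\<close>, the ceiling of n/m.\<close>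
  let ?q = "\<lambda>xs :: nat list. LEAST k. (k # xs) ! 1 * ((k # xs) ! 2 - (k # xs) ! 0 * (k # xs) ! 1) = 0"
  have "computable 2 ?q"
  proof (rule computable_minim)
    fix xs :: "nat list" assume "length xs = 2"
    then obtain m n where "xs = [m, n]"
      by (rule length_2_cases)
    then show "\<exists>k. (k # xs) ! 1 * ((k # xs) ! 2 - (k # xs) ! 0 * (k # xs) ! 1) = 0"
      by (cases "m = 0") (auto intro!: exI[of _ n])
  qed (intro computable_mult computable_diff computable_proj; simp)
  then have "computable 2 (\<lambda>xs. c * (?q xs * (?q xs * ?q xs)))"
    by (intro computable_mult computable_const)
  then obtain F where "total_recursive 2 F" and F: "\<And>xs. length xs = 2 \<Longrightarrow> F xs = c * (?q xs * (?q xs * ?q xs))"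
    unfolding computable_def by blast
  moreover have "c * nat \<lceil>1 / (real m / real n)\<rceil> ^ 3 = F [m, n]" if "m > 0" for m n
    using nat_ceiling_eq_Least[OF that, of n] by (simp add: F power3_eq_cube)
  ultimately show ?thesis
    unfolding effectively_computable_def by blast
qed

subsection \<open>Second moments over boxes\<close>

text \<open>Variances of independent centred variables add up; the induction splits off one
  coordinate. The factor \<open>card D\<close> on the left avoids the exponent
  \<open>card I - 1\<close>.\<close>

lemma sum_PiE_square_of_sum:
  fixes g :: "'b \<Rightarrow> real"
  assumes "finite I" "finite D" and g: "(\<Sum>d\<in>D. g d) = 0"
  shows "real (card D) * (\<Sum>x\<in>I \<rightarrow>\<^sub>E D. (\<Sum>i\<in>I. g (x i))\<^sup>2) =
    real (card I) * real (card D) ^ card I * (\<Sum>d\<in>D. (g d)\<^sup>2)"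
  using assms(1)
proof (induction I rule: finite_induct)
  case (insert i I)
  let ?P = "I \<rightarrow>\<^sub>E D" and ?G = "\<lambda>x. \<Sum>j\<in>I. g (x j)"
  have "(\<Sum>x\<in>insert i I \<rightarrow>\<^sub>E D. (\<Sum>j\<in>insert i I. g (x j))\<^sup>2) =
      (\<Sum>(y, x)\<in>D \<times> ?P. (\<Sum>j\<in>insert i I. g ((x(i := y)) j))\<^sup>2)"
    unfolding PiE_insert_eq
    by (subst sum.reindex[OF inj_combinator[OF insert.hyps(2)]]) (simp add: case_prod_unfold)
  also have "\<dots> = (\<Sum>(y, x)\<in>D \<times> ?P. (g y + ?G x)\<^sup>2)"
  proof (intro sum.cong refl, clarify)
    fix y x
    have "(\<Sum>j\<in>I. g ((x(i := y)) j)) = ?G x"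
      using insert.hyps by (intro sum.cong) auto
    then show "(\<Sum>j\<in>insert i I. g ((x(i := y)) j))\<^sup>2 = (g y + ?G x)\<^sup>2"
      using insert.hyps by simp
  qed
  also have "\<dots> = (\<Sum>y\<in>D. \<Sum>x\<in>?P. (g y)\<^sup>2 + 2 * g y * ?G x + (?G x)\<^sup>2)"
    by (simp add: sum.cartesian_product[symmetric] power2_sum algebra_simps)
  \<comment> \<open>The cross term carries the sum of \<open>g\<close> over \<open>D\<close> as a
    factor, which is zero.\<close>
  also have "\<dots> = real (card ?P) * (\<Sum>y\<in>D. (g y)\<^sup>2) + 2 * (\<Sum>y\<in>D. g y) * (\<Sum>x\<in>?P. ?G x)
      + real (card D) * (\<Sum>x\<in>?P. (?G x)\<^sup>2)"
    by (simp add: sum.distrib flip: sum_distrib_left sum_distrib_right)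
  finally have "(\<Sum>x\<in>insert i I \<rightarrow>\<^sub>E D. (\<Sum>j\<in>insert i I. g (x j))\<^sup>2) =
      real (card D) ^ card I * (\<Sum>y\<in>D. (g y)\<^sup>2) + real (card D) * (\<Sum>x\<in>?P. (?G x)\<^sup>2)"
    using insert.hyps by (simp add: g card_PiE)
  then show ?case
    using insert by (simp add: algebra_simps)
qed simp

text \<open>Markov's inequality for the counting measure.\<close>

lemma card_markov:
  fixes f :: "'a \<Rightarrow> real"
  assumes "finite A" "\<And>x. x \<in> A \<Longrightarrow> 0 \<le> f x"
  shows "t * real (card {x \<in> A. t < f x}) \<le> (\<Sum>x\<in>A. f x)"
proof -
  have "t * real (card {x \<in> A. t < f x}) = (\<Sum>x | x \<in> A \<and> t < f x. t)"
    by simp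
  also have "\<dots> \<le> (\<Sum>x | x \<in> A \<and> t < f x. f x)"
    by (intro sum_mono) auto
  also have "\<dots> \<le> (\<Sum>x\<in>A. f x)"
    using assms by (intro sum_mono2) auto
  finally show ?thesis .
qed

section \<open>Moments of differences in an integer box\<close>

abbreviation int_box :: "nat \<Rightarrow> int set" where
  "int_box N \<equiv> {- int N..int N}"

lemma int_box_Suc: "int_box (Suc N) = insert (- int N - 1) (insert (int N + 1) (int_box N))"
  by auto

lemma sum_int_box: "(\<Sum>a\<in>int_box N. real_of_int a) = 0"
  by (induction N) (simp_all add: int_box_Suc del: of_nat_Suc)

lemma sum_square_int_box: "(\<Sum>a\<in>int_box N. (real_of_int a)\<^sup>2) = real N * (real N + 1) * (2 * real N + 1) / 3"
proof (induction N)
  case (Suc N)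
  have "(\<Sum>a\<in>int_box (Suc N). (real_of_int a)\<^sup>2) =
      2 * (real N + 1)\<^sup>2 + (\<Sum>a\<in>int_box N. (real_of_int a)\<^sup>2)"
    unfolding int_box_Suc by (simp add: power2_eq_square algebra_simps)
  also have "\<dots> = real (Suc N) * (real (Suc N) + 1) * (2 * real (Suc N) + 1) / 3"
    unfolding Suc.IH by (simp add: power2_eq_square field_simps)
  finally show ?case .
qed simp

text \<open>Variance of the difference of two independent uniform elements of
  \<open>int_box N\<close>, each of which has variance N (N + 1) / 3.\<close>

definition diff_var :: "nat \<Rightarrow> real" where
  "diff_var N = 2 * real N * (real N + 1) / 3"

lemma card_int_box_pairs: "real (card (int_box N \<times> int_box N)) = (2 * real N + 1)\<^sup>2"
  by (simp add: card_cartesian_product power2_eq_square nat_add_distrib algebra_simps)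

lemma sum_diff_int_box:
  "(\<Sum>d\<in>int_box N \<times> int_box N. real_of_int (fst d - snd d)) = 0"
proof -
  have "(\<Sum>d\<in>int_box N \<times> int_box N. real_of_int (fst d - snd d)) =
      (\<Sum>a\<in>int_box N. \<Sum>b\<in>int_box N. real_of_int a - real_of_int b)"
    by (simp add: sum.cartesian_product case_prod_unfold)
  then show ?thesis
    by (simp add: sum_subtractf sum_int_box flip: sum_distrib_left)
qed

lemma sum_square_diff_int_box:
  "(\<Sum>d\<in>int_box N \<times> int_box N. (real_of_int (fst d - snd d))\<^sup>2) = (2 * real N + 1)\<^sup>2 * diff_var N"
proof -
  have "(\<Sum>d\<in>int_box N \<times> int_box N. (real_of_int (fst d - snd d))\<^sup>2) =
      (\<Sum>a\<in>int_box N. \<Sum>b\<in>int_box N. (real_of_int a)\<^sup>2 + (real_of_int b)\<^sup>2 - 2 * (real_of_int a * real_of_int b))"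
    by (simp add: sum.cartesian_product case_prod_unfold power2_diff algebra_simps)
  also have "\<dots> = 2 * (2 * real N + 1) * (\<Sum>a\<in>int_box N. (real_of_int a)\<^sup>2)"
    by (simp add: sum.distrib sum_subtractf sum_int_box flip: sum_distrib_left sum_distrib_right)
  also have "\<dots> = (2 * real N + 1)\<^sup>2 * diff_var N"
    unfolding sum_square_int_box diff_var_def by (simp add: power2_eq_square field_simps)
  finally show ?thesis .
qed

lemma diff_var_bounds:
  assumes "N > 0"
  shows "0 < diff_var N" "diff_var N \<le> 4 / 3 * (real N)\<^sup>2"
proof -
  have "real N \<ge> 1"
    using assms by simp
  then show "0 < diff_var N" "diff_var N \<le> 4 / 3 * (real N)\<^sup>2"
    unfolding diff_var_def by (simp, simp add: power2_eq_square field_simps)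
qed

text \<open>Chebyshev's inequality: the summands are centred and at most 4 N^2 in absolute value, so
  the square of their sum has mean at most \<open>card I\<close> times (4 N^2)^2. The scale of the
  threshold matches the normalisation of the squared distance.\<close>

lemma card_deviation_le:
  fixes t :: real
  assumes I: "finite I" "I \<noteq> {}" and N: "N > 0" and t: "t > 0"
  shows "real (card {x \<in> I \<rightarrow>\<^sub>E int_box N \<times> int_box N.
      t * (4 * (real N)\<^sup>2 * card I) < \<bar>\<Sum>i\<in>I. (real_of_int (fst (x i) - snd (x i)))\<^sup>2 - diff_var N\<bar>})
    \<le> card (I \<rightarrow>\<^sub>E int_box N \<times> int_box N) / (t\<^sup>2 * card I)"
proof -
  let ?D = "int_box N \<times> int_box N"
  let ?X = "I \<rightarrow>\<^sub>E ?D"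
  let ?g = "\<lambda>d. (real_of_int (fst d - snd d))\<^sup>2 - diff_var N"
  let ?T = "\<lambda>x. \<Sum>i\<in>I. ?g (x i)"
  let ?s = "t * (4 * (real N)\<^sup>2 * card I)"
  define Q where "Q = real (card ?D)"
  have Q: "Q = (2 * real N + 1)\<^sup>2" "Q > 0"
    unfolding Q_def card_int_box_pairs by simp_all
  have cI: "real (card I) > 0"
    using I by (simp add: card_gt_0_iff)
  have s: "?s > 0"
    using N t cI by simp
  have finX: "finite ?X"
    using I by (intro finite_PiE) auto
  have cX: "real (card ?X) = Q ^ card I"
    using I by (simp add: card_PiE Q_def)
  have "(\<Sum>d\<in>?D. ?g d) = 0"
    using Q unfolding sum_subtractf sum_square_diff_int_box by (simp add: Q_def)
  then have "Q * (\<Sum>x\<in>?X. (?T x)\<^sup>2) = real (card I) * Q ^ card I * (\<Sum>d\<in>?D. (?g d)\<^sup>2)"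
    unfolding Q_def using I by (intro sum_PiE_square_of_sum) auto
  also have "(\<Sum>d\<in>?D. (?g d)\<^sup>2) \<le> (\<Sum>d\<in>?D. (4 * (real N)\<^sup>2)\<^sup>2)"
  proof (intro sum_mono)
    fix d assume d: "d \<in> ?D"
    have "\<bar>real_of_int (fst d - snd d)\<bar> \<le> 2 * real N"
      using d by (auto simp: abs_le_iff)
    then have "(real_of_int (fst d - snd d))\<^sup>2 \<le> (2 * real N)\<^sup>2"
      by (rule abs_le_square_iff[THEN iffD1, OF order_trans]) simp
    then have "(real_of_int (fst d - snd d))\<^sup>2 \<le> 4 * (real N)\<^sup>2"
      by (simp add: power_mult_distrib)
    \<comment> \<open>Both the square and its mean lie between 0 and 4 N^2, so their difference
      obeys the same bound.\<close>
    then have "\<bar>?g d\<bar> \<le> 4 * (real N)\<^sup>2"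
      using diff_var_bounds[OF N] zero_le_power2[of "real_of_int (fst d - snd d)"] unfolding abs_le_iff
      by linarith
    then show "(?g d)\<^sup>2 \<le> (4 * (real N)\<^sup>2)\<^sup>2"
      by (metis abs_ge_zero power2_abs power_mono)
  qed
  also have "\<dots> = Q * (4 * (real N)\<^sup>2)\<^sup>2"
    by (simp add: Q_def)
  finally have "(\<Sum>x\<in>?X. (?T x)\<^sup>2) \<le> card I * Q ^ card I * (4 * (real N)\<^sup>2)\<^sup>2"
    using Q by (simp add: mult_left_mono mult.assoc mult.left_commute[of Q])
  moreover have "?s\<^sup>2 * card {x \<in> ?X. ?s\<^sup>2 < (?T x)\<^sup>2} \<le> (\<Sum>x\<in>?X. (?T x)\<^sup>2)"
    using finX by (intro card_markov) auto
  moreover have "{x \<in> ?X. ?s\<^sup>2 < (?T x)\<^sup>2} = {x \<in> ?X. ?s < \<bar>?T x\<bar>}"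
    using abs_le_square_iff[of "?T x" ?s for x] s by (auto simp flip: not_le)
  ultimately have "?s\<^sup>2 * card {x \<in> ?X. ?s < \<bar>?T x\<bar>} \<le> real (card I) * real (card ?X) * (4 * (real N)\<^sup>2)\<^sup>2"
    by (simp only: cX) 
  then have "(t\<^sup>2 * card I * card {x \<in> ?X. ?s < \<bar>?T x\<bar>}) * (card I * (4 * (real N)\<^sup>2)\<^sup>2)
      \<le> card ?X * (card I * (4 * (real N)\<^sup>2)\<^sup>2)"
    by (simp only: power_mult_distrib power2_eq_square mult_ac)
  then have "t\<^sup>2 * card I * card {x \<in> ?X. ?s < \<bar>?T x\<bar>} \<le> card ?X"
    using cI N by (subst (asm) mult_le_cancel_right_pos) auto
  then show ?thesis
    using cI t by (simp add: pos_le_divide_eq mult.commute)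
qed

text \<open>Markov's inequality for the square of the sum. Its mean is
  \<open>card I * diff_var N\<close>, at most 4/3 N^2 times \<open>card I\<close>; dividing by the
  threshold leaves 1 / (3 t).\<close>

lemma card_large_sum_le:
  fixes t :: real
  assumes I: "finite I" "I \<noteq> {}" and N: "N > 0" and t: "t > 0"
  shows "real (card {x \<in> I \<rightarrow>\<^sub>E int_box N \<times> int_box N.
      t * (4 * (real N)\<^sup>2 * card I) < (\<Sum>i\<in>I. real_of_int (fst (x i) - snd (x i)))\<^sup>2})
    \<le> card (I \<rightarrow>\<^sub>E int_box N \<times> int_box N) / (3 * t)"
proof -
  let ?D = "int_box N \<times> int_box N"
  let ?X = "I \<rightarrow>\<^sub>E ?D"
  let ?S = "\<lambda>x. \<Sum>i\<in>I. real_of_int (fst (x i) - snd (x i))"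
  let ?s = "t * (4 * (real N)\<^sup>2 * card I)"
  let ?c = "real (card {x \<in> ?X. ?s < (?S x)\<^sup>2})"
  define Q where "Q = real (card ?D)"
  have Q: "Q = (2 * real N + 1)\<^sup>2" "Q > 0"
    unfolding Q_def card_int_box_pairs by simp_all
  have cI: "real (card I) > 0"
    using I by (simp add: card_gt_0_iff)
  have finX: "finite ?X"
    using I by (intro finite_PiE) auto
  have cX: "real (card ?X) = Q ^ card I"
    using I by (simp add: card_PiE Q_def)
  have "Q * (\<Sum>x\<in>?X. (?S x)\<^sup>2) = real (card I) * Q ^ card I * (\<Sum>d\<in>?D. (real_of_int (fst d - snd d))\<^sup>2)"
    unfolding Q_def using I sum_diff_int_box by (intro sum_PiE_square_of_sum) auto
  also have "\<dots> = Q * (real (card I) * real (card ?X) * diff_var N)"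
    unfolding sum_square_diff_int_box cX Q(1) by simp
  finally have "(\<Sum>x\<in>?X. (?S x)\<^sup>2) = real (card I) * real (card ?X) * diff_var N"
    using Q by simp
  moreover have "?s * ?c \<le> (\<Sum>x\<in>?X. (?S x)\<^sup>2)"
    using finX by (intro card_markov) auto
  moreover have "real (card I) * real (card ?X) * diff_var N \<le> real (card I) * real (card ?X) * (4 / 3 * (real N)\<^sup>2)"
    using diff_var_bounds[OF N] by (intro mult_left_mono) auto
  ultimately have "?s * ?c \<le> real (card I) * real (card ?X) * (4 / 3 * (real N)\<^sup>2)"
    by linarith
  then have "(3 * t * ?c) * (4 / 3 * (real N)\<^sup>2 * card I) \<le> card ?X * (4 / 3 * (real N)\<^sup>2 * card I)"
    by (simp add: mult_ac)
  then have "3 * t * ?c \<le> card ?X"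
    using cI N by (subst (asm) mult_le_cancel_right_pos) auto
  then show ?thesis
    using t by (simp add: pos_le_divide_eq mult.commute)
qed

subsection \<open>The distance between random elements\<close>

definition lincomb :: "nat \<Rightarrow> (nat \<Rightarrow> int) \<Rightarrow> complex" where
  "lincomb p a = (\<Sum>j=1..p-1. of_int (a j) * root_of_unity p ^ j)"

lemma lincomb_diff: "lincomb p a - lincomb p b = lincomb p (\<lambda>j. a j - b j)"
  by (simp add: lincomb_def sum_subtractf algebra_simps)

text \<open>Coefficient functions in \<open>coeff_box\<close> are arbitrary outside
  \<open>{1..p-1}\<close>; extensional ones leave a single representative of each coefficient
  vector, which makes counting possible.\<close>

lemma coeff_box_eq: "coeff_box p N = lincomb p ` ({1..p-1} \<rightarrow>\<^sub>E int_box N)"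
proof
  show "coeff_box p N \<subseteq> lincomb p ` ({1..p-1} \<rightarrow>\<^sub>E int_box N)"
  proof
    fix z assume "z \<in> coeff_box p N"
    then obtain a where a: "z = lincomb p a" "\<forall>j\<in>{1..p-1}. a j \<in> int_box N"
      by (auto simp: coeff_box_def lincomb_def)
    have "lincomb p (restrict a {1..p-1}) = lincomb p a"
      unfolding lincomb_def by (intro sum.cong) auto
    then show "z \<in> lincomb p ` ({1..p-1} \<rightarrow>\<^sub>E int_box N)"
      using a by (intro image_eqI[of _ _ "restrict a {1..p-1}"]) auto
  qed
  show "lincomb p ` ({1..p-1} \<rightarrow>\<^sub>E int_box N) \<subseteq> coeff_box p N"
    unfolding coeff_box_def lincomb_def by blast
qed

text \<open>
  By Cauchy-Schwarz the squared norm dominates the sum of the squared coefficients, so a vanishing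
  linear combination has vanishing coefficients.
\<close>

lemma inj_on_lincomb:
  assumes p: "Factorial_Ring.prime p"
  shows "inj_on (lincomb p) ({1..p-1} \<rightarrow>\<^sub>E D)"
proof (rule inj_onI)
  fix a b assume ab: "a \<in> {1..p-1} \<rightarrow>\<^sub>E D" "b \<in> {1..p-1} \<rightarrow>\<^sub>E D" "lincomb p a = lincomb p b"
  define c where "c j = a j - b j" for j
  have p1: "p > 1"
    using p by (rule prime_gt_1_nat)
  have "lincomb p c = lincomb p (\<lambda>_. 0)"
    using lincomb_diff[of p a b] ab(3) by (simp add: c_def[abs_def] lincomb_def)
  then have "(real p)\<^sup>2 * (\<Sum>j=1..p-1. (real_of_int (c j))\<^sup>2) = (real p + 1) * (\<Sum>j=1..p-1. real_of_int (c j))\<^sup>2"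
    using trace_norm_lincomb[OF p, of c] trace_norm_lincomb[OF p, of "\<lambda>_. 0"] by (simp add: lincomb_def)
  also have "\<dots> \<le> (real p + 1) * ((\<Sum>j=1..p-1. (real_of_int (c j))\<^sup>2) * card {1..p-1})"
    by (intro mult_left_mono sum_squared_le_sum_of_squares) auto
  \<comment> \<open>(p + 1) (p - 1) falls short of p^2 by 1, so one copy of the sum of squares
    survives the comparison with the left side.\<close>
  also have "\<dots> = ((real p)\<^sup>2 - 1) * (\<Sum>j=1..p-1. (real_of_int (c j))\<^sup>2)"
    using p1 by (simp add: of_nat_diff power2_eq_square algebra_simps)
  finally have "(\<Sum>j=1..p-1. (real_of_int (c j))\<^sup>2) \<le> 0"
    by (simp add: algebra_simps)
  then have "(\<Sum>j=1..p-1. (real_of_int (c j))\<^sup>2) = 0"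
    by (intro antisym sum_nonneg) auto
  then have "\<forall>j\<in>{1..p-1}. c j = 0"
    by (subst (asm) sum_nonneg_eq_0_iff) auto
  then show "a = b"
    using ab by (intro PiE_ext) (auto simp: c_def)
qed

lemma card_coeff_box:
  assumes "Factorial_Ring.prime p"
  shows "card (coeff_box p N) = (2 * N + 1) ^ (p - 1)"
proof -
  have "card (coeff_box p N) = card ({1..p-1} \<rightarrow>\<^sub>E int_box N)"
    unfolding coeff_box_eq by (rule card_image) (rule inj_on_lincomb[OF assms])
  then show ?thesis
    by (simp add: card_PiE nat_add_distrib nat_mult_distrib)
qed

text \<open>The normalised sum of squares has mean diff_var N / (4 N^2) = 1/6 + 1/(6 N). The three
  terms are the fluctuation of U around its mean, the bias 1/(6 N), and the contribution of
  S^2.\<close>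

lemma normalized_dist_lincomb:
  assumes p: "Factorial_Ring.prime p" and N: "N > 0"
  shows "(normalized_dist p N (lincomb p a) (lincomb p b))\<^sup>2 - 1 / 6 =
    (\<Sum>j=1..p-1. (real_of_int (a j - b j))\<^sup>2 - diff_var N) / (4 * (real N)\<^sup>2 * card {1..p-1})
    + 1 / (6 * real N)
    - (real p + 1) / (real p)\<^sup>2 * ((\<Sum>j=1..p-1. real_of_int (a j - b j))\<^sup>2 / (4 * (real N)\<^sup>2 * card {1..p-1}))"
proof -
  define n where "n = real p - 1"
  have p1: "p > 1"
    using p by (rule prime_gt_1_nat)
  have n: "real (card {1..p-1}) = n" "n > 0"
    using p1 by (simp_all add: n_def of_nat_diff)
  define U where "U = (\<Sum>j=1..p-1. (real_of_int (a j - b j))\<^sup>2)"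
  define V where "V = (\<Sum>j=1..p-1. real_of_int (a j - b j))\<^sup>2"
  have "(\<Sum>j=1..p-1. (real_of_int (a j - b j))\<^sup>2 - diff_var N) = U - n * diff_var N"
    using n by (simp add: U_def sum_subtractf)
  moreover have "(normalized_dist p N (lincomb p a) (lincomb p b))\<^sup>2 =
      ((real p)\<^sup>2 * U - (real p + 1) * V) / (4 * (real N)\<^sup>2 * (real p)\<^sup>2 * n)"
    unfolding normalized_dist_def trace_dist_def lincomb_diff power_divide
    using p1 trace_norm_lincomb[OF p, of "\<lambda>j. a j - b j"]
    by (simp add: lincomb_def U_def V_def power_mult_distrib n_def)
  moreover have "((real p)\<^sup>2 * U - (real p + 1) * V) / (4 * (real N)\<^sup>2 * (real p)\<^sup>2 * n) - 1 / 6 =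
    (U - n * diff_var N) / (4 * (real N)\<^sup>2 * n) + 1 / (6 * real N)
    - (real p + 1) / (real p)\<^sup>2 * (V / (4 * (real N)\<^sup>2 * n))"
    using n(2) p1 N unfolding diff_var_def by (simp add: field_simps power2_eq_square)
  ultimately show ?thesis
    by (simp only: n V_def)
qed

text \<open>If the distance is off by more than \<epsilon>, its square is off by more than
  2\<epsilon>/5. The bias accounts for at most \<epsilon>/10, so the fluctuation of U exceeds
  \<epsilon>/5 or the term with S^2 exceeds \<epsilon>/10; the moment bounds control both
  events.\<close>

lemma card_far_pairs_le:
  assumes p: "Factorial_Ring.prime p" and N: "N > 0" and e: "\<epsilon> > 0" and bias: "1 / (6 * real N) \<le> \<epsilon> / 10"
  shows "real (card {(\<alpha>, \<beta>) \<in> coeff_box p N \<times> coeff_box p N.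
      \<bar>normalized_dist p N \<alpha> \<beta> - 1 / sqrt 6\<bar> > \<epsilon>})
    \<le> (real (card (coeff_box p N)))\<^sup>2 * (25 / (\<epsilon>\<^sup>2 * (real p - 1)) + 20 / (3 * \<epsilon> * real p))"
proof -
  let ?I = "{1..p-1}"
  let ?X = "?I \<rightarrow>\<^sub>E int_box N \<times> int_box N"
  let ?T = "\<lambda>x. \<Sum>i\<in>?I. (real_of_int (fst (x i) - snd (x i)))\<^sup>2 - diff_var N"
  let ?S = "\<lambda>x. \<Sum>i\<in>?I. real_of_int (fst (x i) - snd (x i))"
  let ?pair = "\<lambda>x. (lincomb p (\<lambda>i. fst (x i)), lincomb p (\<lambda>i. snd (x i)))"
  let ?k = "4 * (real N)\<^sup>2 * card ?I"
  \<comment> \<open>The factor p^2 / (p + 1) undoes the coefficient of S^2, so \<open>?u\<close> is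
    the threshold at which that term reaches \<epsilon>/10.\<close>
  let ?u = "\<epsilon> / 10 * ((real p)\<^sup>2 / (real p + 1))"
  define B where "B = {(\<alpha>, \<beta>) \<in> coeff_box p N \<times> coeff_box p N. \<bar>normalized_dist p N \<alpha> \<beta> - 1 / sqrt 6\<bar> > \<epsilon>}"
  define B1 where "B1 = {x \<in> ?X. \<epsilon> / 5 * ?k < \<bar>?T x\<bar>}"
  define B2 where "B2 = {x \<in> ?X. ?u * ?k < (?S x)\<^sup>2}"
  have p1: "p > 1"
    using p by (rule prime_gt_1_nat)
  have n: "real (card ?I) = real p - 1"
    using p1 by (simp add: of_nat_diff)
  have k: "?k > 0"
    using p1 N by simp
  have "finite ?X"
    by (intro finite_PiE) auto
  then have fin: "finite B1" "finite B2"
    by (simp_all add: B1_def B2_def)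
  have "B \<subseteq> ?pair ` (B1 \<union> B2)"
  proof
    fix z assume "z \<in> B"
    then obtain a b where ab: "a \<in> ?I \<rightarrow>\<^sub>E int_box N" "b \<in> ?I \<rightarrow>\<^sub>E int_box N"
        "z = (lincomb p a, lincomb p b)" "\<bar>normalized_dist p N (lincomb p a) (lincomb p b) - 1 / sqrt 6\<bar> > \<epsilon>"
      by (auto simp: B_def coeff_box_eq)
    \<comment> \<open>Two coefficient vectors are repackaged as one function into pairs of integers,
      a point of the product space to which the moment bounds apply.\<close>
    define x where "x = restrict (\<lambda>i. (a i, b i)) ?I"
    have x: "x \<in> ?X"
      using ab by (auto simp: x_def)
    have pair: "?pair x = z"
      by (auto simp: ab lincomb_def x_def)
    let ?d = "normalized_dist p N (lincomb p a) (lincomb p b)"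
    have T: "(\<Sum>j=1..p-1. (real_of_int (a j - b j))\<^sup>2 - diff_var N) = ?T x"
      and S: "(\<Sum>j=1..p-1. real_of_int (a j - b j)) = ?S x"
      by (simp_all add: x_def)
    have d: "?d\<^sup>2 - 1 / 6 = ?T x / ?k + 1 / (6 * real N) - (real p + 1) / (real p)\<^sup>2 * ((?S x)\<^sup>2 / ?k)"
      using normalized_dist_lincomb[OF p N, of a b] unfolding T S .
    have "0 \<le> ?d"
      using p1 by (auto simp: normalized_dist_def trace_dist_def trace_norm_def intro!: divide_nonneg_nonneg sum_nonneg)
    \<comment> \<open>Since 6 \<le> (5/2)^2, the factor \<open>?d + 1 / sqrt 6\<close> is at least
      2/5.\<close>
    have "sqrt 6 \<le> 5 / 2"
      by (rule real_le_lsqrt) (auto simp: power2_eq_square)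
    then have "2 / 5 \<le> 1 / sqrt 6"
      by (simp add: field_simps)
    then have "2 / 5 * \<epsilon> < (?d + 1 / sqrt 6) * \<bar>?d - 1 / sqrt 6\<bar>"
      using ab(4) e \<open>0 \<le> ?d\<close> by (intro mult_le_less_imp_less) auto
    also have "\<dots> = \<bar>?d\<^sup>2 - 1 / 6\<bar>"
    proof -
      have "?d\<^sup>2 - 1 / 6 = (?d + 1 / sqrt 6) * (?d - 1 / sqrt 6)"
        by (simp add: power2_eq_square algebra_simps)
      then show ?thesis
        using \<open>0 \<le> ?d\<close> by (simp add: abs_mult)
    qed
    also have "\<dots> \<le> \<bar>?T x\<bar> / ?k + \<epsilon> / 10 + (real p + 1) / (real p)\<^sup>2 * ((?S x)\<^sup>2 / ?k)"
    proof -
      have "\<bar>?T x / ?k\<bar> = \<bar>?T x\<bar> / ?k"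
        using k by simp
      moreover have "0 \<le> (real p + 1) / (real p)\<^sup>2 * ((?S x)\<^sup>2 / ?k)"
        by simp
      moreover have "0 \<le> 1 / (6 * real N)"
        by simp
      ultimately show ?thesis
        using d bias by linarith
    qed
    finally have "\<epsilon> / 5 < \<bar>?T x\<bar> / ?k \<or> \<epsilon> / 10 < (real p + 1) / (real p)\<^sup>2 * ((?S x)\<^sup>2 / ?k)"
      by linarith
    then have "x \<in> B1 \<union> B2"
    proof
      assume "\<epsilon> / 5 < \<bar>?T x\<bar> / ?k"
      then have "\<epsilon> / 5 * ?k < \<bar>?T x\<bar>"
        by (simp only: pos_less_divide_eq[OF k])
      with x have "x \<in> B1"
        unfolding B1_def by (intro CollectI conjI)
      then show ?thesis ..
    next
      assume *: "\<epsilon> / 10 < (real p + 1) / (real p)\<^sup>2 * ((?S x)\<^sup>2 / ?k)"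
      have "?u * ?k < (real p + 1) / (real p)\<^sup>2 * ((?S x)\<^sup>2 / ?k) * ((real p)\<^sup>2 / (real p + 1)) * ?k"
        using * k p1 by (intro mult_strict_right_mono) auto
      also have "\<dots> = (?S x)\<^sup>2"
      proof -
        have "(real p + 1) / (real p)\<^sup>2 * s * ((real p)\<^sup>2 / (real p + 1)) = s" for s
          using p1 by simp
        moreover have "s / ?k * ?k = s" for s
          using less_imp_neq[OF k] by (metis nonzero_eq_divide_eq)
        ultimately show ?thesis
          by (simp only:)
      qed
      finally show ?thesis
        using x by (simp add: B2_def)
    qed
    then show "z \<in> ?pair ` (B1 \<union> B2)"
      using pair by blast
  qed
  then have "card B \<le> card (?pair ` (B1 \<union> B2))"
    using fin by (intro card_mono) auto
  also have "\<dots> \<le> card (B1 \<union> B2)"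
    using fin by (intro card_image_le) auto
  also have "\<dots> \<le> card B1 + card B2"
    by (rule card_Un_le)
  finally have "real (card B) \<le> real (card B1) + real (card B2)"
    by linarith
  also have "real (card B1) \<le> card ?X / ((\<epsilon> / 5)\<^sup>2 * card ?I)"
    unfolding B1_def using p1 N e by (intro card_deviation_le) auto
  also have "\<dots> = card ?X * (25 / (\<epsilon>\<^sup>2 * (real p - 1)))"
    unfolding n by (simp add: power_divide field_simps)
  also have "real (card B2) \<le> card ?X / (3 * ?u)"
    unfolding B2_def using p1 N e by (intro card_large_sum_le) auto
  also have "\<dots> = card ?X * (10 * ((real p + 1) / (real p)\<^sup>2) / (3 * \<epsilon>))"
    using e p1 by (simp add: field_simps)
  also have "\<dots> \<le> card ?X * (20 / (3 * \<epsilon> * real p))"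
  proof (rule mult_left_mono)
    have "(real p + 1) / (real p)\<^sup>2 \<le> 2 / real p"
      using p1 by (simp add: field_simps power2_eq_square)
    then have "10 * ((real p + 1) / (real p)\<^sup>2) / (3 * \<epsilon>) \<le> 10 * (2 / real p) / (3 * \<epsilon>)"
      using e by (intro divide_right_mono mult_left_mono) auto
    then show "10 * ((real p + 1) / (real p)\<^sup>2) / (3 * \<epsilon>) \<le> 20 / (3 * \<epsilon> * real p)"
      by (simp add: mult.commute)
  qed simp
  \<comment> \<open>Distinct coefficient vectors give distinct elements, so there are as many
    functions into pairs as pairs of elements of the box.\<close>
  also have "real (card ?X) = (real (card (coeff_box p N)))\<^sup>2"
  proof -
    have "card (int_box N \<times> int_box N) = (2 * N + 1)\<^sup>2"
      by (simp add: card_cartesian_product power2_eq_square nat_add_distrib nat_mult_distrib)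
    then have "card ?X = ((2 * N + 1)\<^sup>2) ^ (p - 1)"
      by (simp only: card_funcsetE[OF finite_atLeastAtMost] card_atLeastAtMost diff_Suc_1)
    also have "\<dots> = (card (coeff_box p N))\<^sup>2"
      unfolding card_coeff_box[OF p] by (simp only: mult.commute flip: power_mult)
    finally show ?thesis
      by (simp only: of_nat_power)
  qed
  finally show ?thesis
    unfolding B_def by (simp add: distrib_left)
qed

theorem theorem1p1:
  "\<exists>A :: real \<Rightarrow> nat. effectively_computable A \<and>
     (\<forall>\<epsilon>>0. \<forall>p N :: nat. Factorial_Ring.prime p \<and> odd p \<and> N > 0 \<and> N > A \<epsilon> \<and> p > A \<epsilon> \<longrightarrow>
        1 / (real (card (coeff_box p N)))\<^sup>2 *
          real (card {(\<alpha>, \<beta>) \<in> coeff_box p N \<times> coeff_box p N.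
                       \<bar>normalized_dist p N \<alpha> \<beta> - 1 / sqrt 6\<bar> > \<epsilon>}) < \<epsilon>)"
proof (intro exI conjI allI impI)
  \<comment> \<open>The cube comes from the term 25 / (\<epsilon>^2 (p - 1)), which is at most
    \<epsilon>/4 once p - 1 \<ge> 100 / \<epsilon>^3. For \<epsilon> \<le> 1 the other term is then
    at most \<epsilon>/15.\<close>
  let ?A = "\<lambda>x :: real. 100 * nat \<lceil>1 / x\<rceil> ^ 3"
  show "effectively_computable ?A"
    by (rule effectively_computable_ceiling_inverse_power)
  fix \<epsilon> :: real and p N :: nat
  assume e: "\<epsilon> > 0"
    and "Factorial_Ring.prime p \<and> odd p \<and> N > 0 \<and> N > ?A \<epsilon> \<and> p > ?A \<epsilon>"
  then have p: "Factorial_Ring.prime p" and N: "N > 0" and NA: "N > ?A \<epsilon>" and pA: "p > ?A \<epsilon>"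
    by auto
  define c where "c = real (card (coeff_box p N))"
  let ?B = "{(\<alpha>, \<beta>) \<in> coeff_box p N \<times> coeff_box p N. \<bar>normalized_dist p N \<alpha> \<beta> - 1 / sqrt 6\<bar> > \<epsilon>}"
  have c: "c > 0"
    unfolding c_def card_coeff_box[OF p] by simp
  have "real (card ?B) < \<epsilon> * c\<^sup>2"
  \<comment> \<open>For \<epsilon> > 1 the claim is trivial, as a proportion never exceeds 1;
    otherwise 1/\<epsilon> \<ge> 1, so its powers increase with the exponent.\<close>
  proof (cases "\<epsilon> > 1")
    case True
    have fin: "finite (coeff_box p N)"
      using c unfolding c_def by (auto intro: card_ge_0_finite)
    then have "card ?B \<le> card (coeff_box p N \<times> coeff_box p N)"
      by (intro card_mono) auto
    then have "real (card ?B) \<le> c\<^sup>2"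
      unfolding c_def by (simp add: card_cartesian_product power2_eq_square flip: of_nat_mult)
    also have "\<dots> < \<epsilon> * c\<^sup>2"
      using True c by simp
    finally show ?thesis .
  next
    case False
    define y where "y = 1 / \<epsilon>"
    have y: "y \<ge> 1" "\<epsilon> = 1 / y"
      using False e by (simp_all add: y_def)
    have "y ^ 3 \<le> real (nat \<lceil>y\<rceil>) ^ 3"
      using y by (intro power_mono real_nat_ceiling_ge) auto
    then have "100 * y ^ 3 \<le> real (?A \<epsilon>)"
      by (simp add: y_def)
    \<comment> \<open>The strict inequality between integers gives the bound for
      \<open>p - 1\<close> and not only for \<open>p\<close>.\<close>
    then have large: "100 * y ^ 3 \<le> real N" "100 * y ^ 3 \<le> real p - 1"
      using NA pA by linarith+
    have y3: "y \<le> y ^ 3" "y ^ 2 \<le> y ^ 3"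
      using power_increasing[of 1 3 y] power_increasing[of 2 3 y] y by simp_all
    have "10 * y \<le> 6 * real N"
      using large(1) y3(1) y(1) by linarith
    then have "1 / (6 * real N) \<le> 1 / (10 * y)"
      using y(1) by (intro frac_le) simp_all
    then have "1 / (6 * real N) \<le> \<epsilon> / 10"
      by (simp add: y)
    then have "real (card ?B) \<le> c\<^sup>2 * (25 / (\<epsilon>\<^sup>2 * (real p - 1)) + 20 / (3 * \<epsilon> * real p))"
      unfolding c_def by (rule card_far_pairs_le[OF p N e])
    also have "\<dots> < c\<^sup>2 * \<epsilon>"
    proof (rule mult_strict_left_mono)
      have "\<epsilon>\<^sup>2 * (100 * y ^ 3) \<le> \<epsilon>\<^sup>2 * (real p - 1)"
        using large(2) by (rule mult_left_mono) simp
      then have "25 / (\<epsilon>\<^sup>2 * (real p - 1)) \<le> 25 / (\<epsilon>\<^sup>2 * (100 * y ^ 3))"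
        using e y(1) by (intro frac_le) simp_all
      also have "\<dots> = \<epsilon> / 4"
        using y(1) unfolding y(2) by (simp add: power2_eq_square power3_eq_cube)
      finally have "25 / (\<epsilon>\<^sup>2 * (real p - 1)) \<le> \<epsilon> / 4" .
      moreover
      have "100 * y ^ 2 \<le> real p"
        using large(2) y3(2) by linarith
      then have "3 * \<epsilon> * (100 * y ^ 2) \<le> 3 * \<epsilon> * real p"
        by (rule mult_left_mono) (use e in simp)
      then have "20 / (3 * \<epsilon> * real p) \<le> 20 / (3 * \<epsilon> * (100 * y ^ 2))"
        using e y(1) by (intro frac_le) simp_all
      moreover have "20 / (3 * \<epsilon> * (100 * y ^ 2)) = \<epsilon> / 15"
        using y(1) unfolding y(2) by (simp add: power2_eq_square)
      ultimately show "25 / (\<epsilon>\<^sup>2 * (real p - 1)) + 20 / (3 * \<epsilon> * real p) < \<epsilon>"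
        using e by linarith
    qed (use c in simp)
    finally show ?thesis
      by (simp add: mult.commute)
  qed
  moreover have "1 / c\<^sup>2 * b < \<epsilon>" if "b < \<epsilon> * c\<^sup>2" for b
    using that c by (simp add: field_simps)
  ultimately have "1 / c\<^sup>2 * real (card ?B) < \<epsilon>"
    by blast
  then show "1 / (real (card (coeff_box p N)))\<^sup>2 * real (card ?B) < \<epsilon>"
    unfolding c_def .
qed

end
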